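(* For all integers $n,\beta\ge 0$ and $k\ge 1$, we have $$b_{7^{2k-1}}\left(7^{2k+2\beta-1}n+\frac{18\cdot 7^{2k+2\beta-1}-7^{2k-1}+1}{24}\right)\equiv 0 \pmod{7^{k+\beta}}$$ and $$b_{7^{2k}}\left(7^{2k+\beta-1}(n+1)-\frac{7^{2k}-1}{24}\right)\equiv 0\pmod{7^{k+\beta}}.$$
   Context: For a positive integer $\ell$, a partition of a nonnegative integer $n$ is called $\ell$-regular if none of its parts is divisible by $\ell$. $b_\ell(n)$ denotes the number of $\ell$-regular partitions of $n$ (with $b_\ell(0)=1$), so that $\sum_{n\ge0}b_\ell(n)q^n=\prod_{m\ge1}\frac{1-q^{\ell m}}{1-q^m}$. *)

theory Defs
  imports "HOL-Number_Theory.Cong" "HOL-Library.Multiset"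
begin

text \<open>A partition of \<open>n\<close> is a finite multiset of positive integers with sum \<open>n\<close>.\<close>

definition regular_partitions :: "nat \<Rightarrow> nat \<Rightarrow> nat multiset set" where
  "regular_partitions l n =
     {P. (\<forall>p\<in>#P. p > 0) \<and> sum_mset P = n \<and> (\<forall>p\<in>#P. \<not> l dvd p)}"

definition b_reg :: "nat \<Rightarrow> nat \<Rightarrow> nat" where
  "b_reg l n = card (regular_partitions l n)"

text \<open>The set counted by \<^const>\<open>b_reg\<close> is finite, so its cardinality is not the default value \<open>0\<close>.\<close>

lemma finite_regular_partitions: "finite (regular_partitions l n)"
proof (rule finite_subset)
  have size_le: "size P \<le> sum_mset P" if "\<forall>p\<in>#P. p > 0" for P :: "nat multiset"
    using that by (induction P) auto
  show "regular_partitions l n \<subseteq> mset ` {xs. set xs \<subseteq> {..n} \<and> length xs \<le> n}"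
  proof
    fix P assume P: "P \<in> regular_partitions l n"
    obtain xs where xs: "mset xs = P" using ex_mset by blast
    have "size P \<le> n" using P size_le[of P] by (auto simp: regular_partitions_def)
    moreover have "p \<le> n" if "p \<in># P" for p
      using P sum_mset.remove[OF that] by (auto simp: regular_partitions_def)
    ultimately show "P \<in> mset ` {xs. set xs \<subseteq> {..n} \<and> length xs \<le> n}"
      using xs by (auto intro!: image_eqI[of _ _ xs])
  qed
  show "finite (mset ` {xs. set xs \<subseteq> {..n} \<and> length xs \<le> n})"
    by (intro finite_imageI finite_lists_length_le) simp
qed

lemma b_reg_0 [simp]: "b_reg l 0 = 1"
proof -
  have "regular_partitions l 0 = {{#}}"
    by (auto simp: regular_partitions_def) (metis multiset_nonemptyE not_less_zero)
  then show ?thesis by (simp add: b_reg_def)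
qed

text \<open>For positive \<open>k\<close>, the following facts show that natural-number division by \<open>24\<close> is exact
  and natural-number subtraction does not truncate in the arguments of \<^const>\<open>b_reg\<close> to which
  they are applied.\<close>

lemma seven_odd_power_mod_24: "(7::nat) ^ (2 * m + 1) mod 24 = 7"
proof (induction m)
  case (Suc m)
  have "(7::nat) ^ (2 * Suc m + 1) = 49 * 7 ^ (2 * m + 1)" by simp
  also have "\<dots> mod 24 = 49 * (7 ^ (2 * m + 1) mod 24) mod 24" by (simp only: mod_mult_right_eq)
  finally show ?case using Suc by simp
qed simp

lemma odd_argument_no_truncation:
  fixes k \<beta> :: nat
  assumes "k \<ge> 1"
  shows "(7::nat) ^ (2*k - 1) \<le> 18 * 7 ^ (2*k + 2*\<beta> - 1)"
proof -
  have "(7::nat) ^ (2*k - 1) \<le> 7 ^ (2*k + 2*\<beta> - 1)" by (rule power_increasing) auto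
  then show ?thesis by linarith
qed

lemma odd_argument_exact:
  fixes k \<beta> :: nat
  assumes "k \<ge> 1"
  shows "(24::nat) dvd 18 * 7 ^ (2*k + 2*\<beta> - 1) - 7 ^ (2*k - 1) + 1"
proof -
  have "2*k + 2*\<beta> - 1 = 2 * (k + \<beta> - 1) + 1" using assms by simp
  then have "(7::nat) ^ (2*k + 2*\<beta> - 1) mod 24 = 7"
    by (simp only: seven_odd_power_mod_24)
  moreover have "2*k - 1 = 2 * (k - 1) + 1" using assms by simp
  then have "(7::nat) ^ (2*k - 1) mod 24 = 7"
    by (simp only: seven_odd_power_mod_24)
  ultimately obtain c d :: nat where
      c: "(7::nat) ^ (2*k + 2*\<beta> - 1) = 24 * c + 7" and d: "(7::nat) ^ (2*k - 1) = 24 * d + 7"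
    by (metis mult_div_mod_eq)
  have "24 * d + 7 \<le> 18 * (24 * c + 7)"
    using odd_argument_no_truncation[OF assms, of \<beta>] unfolding c d .
  then have "18 * (24 * c + 7) - (24 * d + 7) + 1 = 24 * (18 * c + 5 - d)" by simp
  then show ?thesis unfolding c d by simp
qed

lemma even_argument_exact: "(24::nat) dvd 7 ^ (2*k) - 1"
proof (induction k)
  case (Suc k)
  then obtain c :: nat where "7 ^ (2*k) - 1 = 24 * c" by (elim dvdE)
  moreover have "(7::nat) ^ (2*k) \<ge> 1" by simp
  ultimately have "(7::nat) ^ (2*k) = 24 * c + 1" by linarith
  then have "(7::nat) ^ (2 * Suc k) = 49 * (24 * c + 1)" by simp
  then have "(7::nat) ^ (2 * Suc k) - 1 = 24 * (49 * c + 2)" by (simp only:) simp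
  then show ?case by (metis dvd_triv_left)
qed simp

lemma even_argument_no_truncation:
  fixes k \<beta> n :: nat
  assumes "k \<ge> 1"
  shows "((7::nat) ^ (2*k) - 1) div 24 \<le> 7 ^ (2*k + \<beta> - 1) * (n + 1)"
proof -
  have "(7::nat) ^ (2*k) = 7 * 7 ^ (2*k - 1)" using assms by (cases k) auto
  moreover have "(7::nat) ^ (2*k - 1) \<le> 7 ^ (2*k + \<beta> - 1)" by (rule power_increasing) auto
  moreover have "(7::nat) ^ (2*k + \<beta> - 1) \<le> 7 ^ (2*k + \<beta> - 1) * (n + 1)" by simp
  ultimately show ?thesis by linarith
qed

end

theory Submission
  imports Defs "HOL-Computational_Algebra.Formal_Power_Series" "HOL-Computational_Algebra.Polynomial"
begin

text \<open>
  Write \<open>E\<^sub>m = \<Prod> (1 - q\<^sup>m\<^sup>i)\<close> (the constant \<open>euler\<close>) and let \<open>U\<^sub>7\<close> keep the coefficients of the powers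
  \<open>q\<^sup>7\<^sup>n\<close>. The generating function of the \<open>7\<^sup>r\<close>-regular partitions is \<open>E\<^bsub>7^r\<^esub> / E\<^sub>1\<close>. As long as the
  modulus divides \<open>7\<^sup>r\<close>, selecting the coefficients in an arithmetic progression does not see
  the numerator, which is a series in \<open>q\<^bsup>7^r\<^esup>\<close>. So for the first \<open>2k - 1\<close> selections of residues modulo \<open>7\<close>
  the task is Watson's: follow \<open>1 / E\<^sub>1\<close>, that is, the partition function. By then the numerator has shrunk to
  \<open>E\<^sub>1\<close> or \<open>E\<^sub>7\<close>, and up to a power of \<open>q\<close> the series has become a
  polynomial in \<open>t = q E\<^sub>7\<^sup>4 / E\<^sub>1\<^sup>4\<close> with all coefficients divisible by \<open>7\<^sup>k\<close>, multiplied by \<open>E\<^sub>1 / E\<^sub>7\<close> if the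
  exponent of \<open>7\<close> is odd (\<open>Watson_partition_series\<close>, \<open>b_reg_progression\<close>). From there on one iterates \<open>U\<^sub>7\<close> on
  polynomials in \<open>t\<close>, or a pair of similar selections on \<open>E\<^sub>1 / E\<^sub>7\<close> times such a polynomial, and each iteration
  wins one more factor \<open>7\<close>.

  All these operators come from one family. Put \<open>w = q\<^sup>2 E\<^sub>4\<^sub>9 / E\<^sub>1\<close>. Because
  \<open>t(q) t(q\<^sup>7) = w\<^sup>4\<close>, the series \<open>U\<^sub>7(w\<^sup>c t\<^sup>i)\<close> is \<open>t\<^sup>-\<^sup>i U\<^sub>7(w\<^bsup>4i+c\<^esup>)\<close>, so that it suffices to know \<open>U\<^sub>7(w\<^sup>n)\<close>.
  The seven conjugates \<open>w(\<zeta> q)\<close>, \<open>\<zeta>\<^sup>7 = 1\<close>, are the roots of an explicit polynomial of degree \<open>7\<close> over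
  \<open>\<int>[t(q\<^sup>7)]\<close>, and Newton's identities turn it into a recursion for their power sums
  \<open>7 U\<^sub>7(w\<^sup>n)(q\<^sup>7)\<close>. Hence \<open>U\<^sub>7(w\<^sup>n)\<close> is an integer polynomial in \<open>t\<close> (\<open>U7_eta_quot_power\<close>), and induction
  along the recursion shows that \<open>7\<close> divides its \<open>j\<close>-th coefficient at least \<open>(7j - 2n - 1) div 4\<close>
  times (\<open>coeff_U_poly\<close>). The rest of the \<open>7\<close>-adic argument is bookkeeping with this bound.

  The polynomial of degree \<open>7\<close> is found by elementary means. Euler's pentagonal number theorem splits \<open>E\<^sub>1\<close> into
  \<open>a + b + d - e\<close> by residues of the exponents modulo \<open>7\<close>, with \<open>e = q\<^sup>2 E\<^sub>4\<^sub>9\<close>. Jacobi's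
  series for \<open>E\<^sub>1\<^sup>3\<close> has no exponents in three of the residue classes, and in a fourth one it reproduces itself;
  comparing with \<open>(a + b + d - e)\<^sup>3\<close> gives three cubic relations and \<open>a b d = - e\<^sup>3\<close>.
  These relations imply the wanted equation for \<open>E\<^sub>1\<close> over the ring generated by
  \<open>e\<close> and \<open>T = - (a\<^sup>3 b + b\<^sup>3 d + d\<^sup>3 a) - 8 e\<^sup>4\<close> (\<open>septic_identity\<close>). Its constant term is the norm of \<open>E\<^sub>1\<close>, which is
  also the product of all \<open>E\<^sub>1(\<zeta> q)\<close>; evaluating that product identifies \<open>T\<close> as \<open>q E\<^sub>7\<^sup>4\<close> (\<open>modular_equation_euler\<close>).
\<close>

unbundle fps_syntax

section \<open>Euler products and the pentagonal number theorem\<close>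

abbreviation q :: "complex fps" where "q \<equiv> fps_X"

text \<open>Infinite products are handled through their truncations: two series agree if all their
  truncations do, and agreement up to degree \<open>n\<close> is a congruence, being equality modulo \<open>q\<^bsup>n+1\<^esup>\<close>.\<close>

definition eq_upto :: "nat \<Rightarrow> complex fps \<Rightarrow> complex fps \<Rightarrow> bool" where
  "eq_upto n f g \<longleftrightarrow> (\<forall>j\<le>n. f $ j = g $ j)"

lemma eq_upto_refl [simp]: "eq_upto n f f"
  by (simp add: eq_upto_def)

lemma eq_upto_sym: "eq_upto n f g \<Longrightarrow> eq_upto n g f"
  by (simp add: eq_upto_def)

lemma eq_upto_trans: "eq_upto n f g \<Longrightarrow> eq_upto n g h \<Longrightarrow> eq_upto n f h"
  by (simp add: eq_upto_def)

lemma eq_upto_mult: "eq_upto n f f' \<Longrightarrow> eq_upto n g g' \<Longrightarrow> eq_upto n (f * g) (f' * g')"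
  by (auto simp: eq_upto_def fps_mult_nth intro!: sum.cong)

lemma eq_upto_power: "eq_upto n f g \<Longrightarrow> eq_upto n (f ^ k) (g ^ k)"
  by (induction k) (auto intro: eq_upto_mult)

lemma eq_upto_prod: "(\<And>i. i \<in> A \<Longrightarrow> eq_upto n (f i) (g i)) \<Longrightarrow> eq_upto n (prod f A) (prod g A)"
  by (induction A rule: infinite_finite_induct) (auto intro!: eq_upto_mult)

lemma eq_uptoI_all: "(\<And>n. eq_upto n f g) \<Longrightarrow> f = g"
  by (auto simp: eq_upto_def fps_eq_iff)

definition qpoch :: "nat \<Rightarrow> nat \<Rightarrow> complex fps" where
  "qpoch m N = (\<Prod>i=1..N. 1 - q ^ (m * i))"

text \<open>The coefficient of \<open>q\<^sup>n\<close> in \<open>\<Prod> (1 - q\<^sup>m\<^sup>i)\<close> is not affected by factors with \<open>i > n\<close>.\<close>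

definition euler :: "nat \<Rightarrow> complex fps" where
  "euler m = Abs_fps (\<lambda>n. qpoch m n $ n)"

lemma qpoch_0 [simp]: "qpoch m 0 = 1"
  by (simp add: qpoch_def)

lemma qpoch_Suc: "qpoch m (Suc N) = qpoch m N * (1 - q ^ (m * Suc N))"
  by (simp add: qpoch_def)

lemma qpoch_nth_0 [simp]: "m \<ge> 1 \<Longrightarrow> qpoch m N $ 0 = 1"
  by (induction N) (simp_all add: qpoch_Suc)

lemma eq_upto_qpoch:
  assumes "m \<ge> 1" "n \<le> N"
  shows "eq_upto n (qpoch m n) (qpoch m N)"
  using assms(2)
proof (induction N rule: dec_induct)
  case (step N)
  have "eq_upto n 1 (1 - q ^ (m * Suc N))"
    unfolding eq_upto_def
  proof (intro allI impI)
    fix j assume "j \<le> n"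
    hence "j < 1 * Suc N" using step(1) by simp
    also have "1 * Suc N \<le> m * Suc N" using assms(1) by (intro mult_le_mono1)
    finally have "j \<noteq> m * Suc N" by (rule less_imp_neq)
    thus "1 $ j = (1 - q ^ (m * Suc N)) $ j" by simp
  qed
  hence "eq_upto n (qpoch m N * 1) (qpoch m (Suc N))"
    unfolding qpoch_Suc by (intro eq_upto_mult) simp_all
  thus ?case using step.IH by (auto intro: eq_upto_trans)
qed simp

lemma eq_upto_euler:
  assumes "m \<ge> 1" "n \<le> N"
  shows "eq_upto n (euler m) (qpoch m N)"
  unfolding eq_upto_def
proof (intro allI impI)
  fix j assume "j \<le> n"
  hence "eq_upto j (qpoch m j) (qpoch m N)" using assms by (intro eq_upto_qpoch) auto
  thus "euler m $ j = qpoch m N $ j" by (simp add: euler_def eq_upto_def)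
qed

lemma euler_nth_0 [simp]: "m \<ge> 1 \<Longrightarrow> euler m $ 0 = 1"
  by (simp add: euler_def)

lemma euler_nonzero [simp]: "m \<ge> 1 \<Longrightarrow> euler m \<noteq> 0"
  using euler_nth_0[of m] by force

lemma dil_nth: "m \<ge> 1 \<Longrightarrow> (f oo q ^ m) $ n = (if m dvd n then f $ (n div m) else 0)"
proof -
  assume m: "m \<ge> 1"
  have eq: "(f oo q ^ m) $ n = (\<Sum>i=0..n. if m * i = n then f $ i else 0)"
    unfolding fps_compose_nth by (intro sum.cong) (auto simp flip: power_mult)
  show ?thesis
  proof (cases "m dvd n")
    case True
    then obtain k where n: "n = m * k" by blast
    have "(\<Sum>i=0..n. if m * i = n then f $ i else 0) = (\<Sum>i=0..n. if k = i then f $ i else 0)"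
      using m n by (intro sum.cong) auto
    also have "\<dots> = f $ k" using m n by simp
    finally show ?thesis using m n eq by simp
  next
    case False
    hence "(\<Sum>i=0..n. if m * i = n then f $ i else 0) = (0 :: complex)"
      by (intro sum.neutral) auto
    thus ?thesis using False eq by simp
  qed
qed

lemma qpoch_dil: "m \<ge> 1 \<Longrightarrow> qpoch l N oo q ^ m = qpoch (m * l) N"
  unfolding qpoch_def
proof (subst fps_compose_prod_distrib)
  assume m: "m \<ge> 1"
  have "(1 - q ^ (l * i)) oo q ^ m = 1 - q ^ (m * l * i)" for i
  proof -
    have "q ^ (l * i) oo q ^ m = (q oo q ^ m) ^ (l * i)"
      using m by (intro fps_compose_power[symmetric]) (simp add: zero_power)
    also have "q oo q ^ m = q ^ m" using m by (simp add: fps_X_fps_compose_startby0)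
    finally show ?thesis by (simp add: fps_compose_sub_distrib power_mult [symmetric] mult.assoc)
  qed
  thus "(\<Prod>k = 1..N. (1 - q ^ (l * k)) oo q ^ m) = (\<Prod>i = 1..N. 1 - q ^ (m * l * i))"
    by simp
qed (simp add: zero_power)

lemma euler_dil:
  assumes "m \<ge> 1" "l \<ge> 1"
  shows "euler l oo q ^ m = euler (m * l)"
proof (rule eq_uptoI_all)
  fix n
  have "(euler l oo q ^ m) $ j = euler (m * l) $ j" for j
  proof -
    have "euler (m * l) $ j = (qpoch l j oo q ^ m) $ j"
      using assms by (simp add: euler_def qpoch_dil)
    also have "\<dots> = (if m dvd j then qpoch l j $ (j div m) else 0)"
      using assms by (simp add: dil_nth)
    also have "qpoch l j $ (j div m) = euler l $ (j div m)"
      using eq_upto_euler[of l "j div m" j] assms by (auto simp: eq_upto_def)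
    finally show ?thesis using assms by (simp add: dil_nth)
  qed
  thus "eq_upto n (euler l oo q ^ m) (euler (m * l))" by (simp add: eq_upto_def)
qed

text \<open>Exponents are kept in this recursive form, which is free of division and truncated subtraction.\<close>

fun tri :: "nat \<Rightarrow> nat" where
  "tri 0 = 0"
| "tri (Suc n) = tri n + Suc n"

lemma tri_double: "2 * tri n = n * (n + 1)"
  by (induction n) auto

lemma tail_sum:
  fixes c :: "nat \<Rightarrow> complex fps"
  shows "(\<Sum>s<n. c (Suc s) * (1 - q ^ Suc s)) = (\<Sum>s\<le>n. c s * (1 - q ^ s))"
  by (induction n) auto

text \<open>Only the summand \<open>s = 0\<close> on the left, the truncated Euler product, matters for the coefficient of \<open>q\<^sup>n\<close>,
  so that this finite identity of Shanks yields the pentagonal number theorem without a limit. The induction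
  step splits off \<open>1 - q\<^bsup>n+1\<^esup>\<close> from the products and moves the part with \<open>q\<^bsup>n+1\<^esup>\<close> from index \<open>s\<close> to \<open>s + 1\<close>;
  there it combines with the other part to the summand for \<open>n\<close>, except at the upper end, where the two new
  pentagonal terms appear.\<close>

lemma Shanks_identity:
  "(\<Sum>s\<le>n. (-1) ^ s * (\<Prod>i\<in>{s<..n}. 1 - q ^ i) * q ^ (s * n + tri s)) =
   1 + (\<Sum>k=1..n. (-1) ^ k * (q ^ (k * (k - 1) + tri k) + q ^ (k * k + tri k)))"
proof (induction n)
  case (Suc n)
  define P where "P = (\<lambda>s. \<Prod>i\<in>{s<..n}. 1 - q ^ i)"
  define c where "c = (\<lambda>s. (-1) ^ s * P s * q ^ (s * n + tri s))"
  define u where "u = (\<lambda>s. (-1) ^ s * P s * q ^ (Suc s * n + tri (Suc s)))"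
  have P_Suc: "(\<Prod>i\<in>{s<..Suc n}. 1 - q ^ i) = P s * (1 - q ^ Suc n)" if "s \<le> n" for s
  proof -
    have "{s<..Suc n} = insert (Suc n) {s<..n}" using that by auto
    thus ?thesis by (simp add: P_def mult.commute)
  qed
  have P_pred: "P s = P (Suc s) * (1 - q ^ Suc s)" if "s < n" for s
  proof -
    have "{s<..n} = insert (Suc s) {Suc s<..n}" using that by auto
    thus ?thesis by (simp add: P_def mult.commute)
  qed
  have u_c: "u s = - (c (Suc s) * (1 - q ^ Suc s))" if "s < n" for s
    unfolding u_def c_def P_pred[OF that] by (simp add: mult.assoc mult.left_commute mult.commute)
  have summand: "(-1) ^ s * (\<Prod>i\<in>{s<..Suc n}. 1 - q ^ i) * q ^ (s * Suc n + tri s) = c s * q ^ s - u s"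
    if "s \<le> n" for s
    unfolding P_Suc[OF that] c_def u_def by (simp add: algebra_simps power_add)
  have "(\<Sum>s\<le>n. c s * q ^ s - u s) = (\<Sum>s\<le>n. c s * q ^ s) - (\<Sum>s<n. u s) - u n"
    by (simp add: sum_subtractf lessThan_Suc_atMost[symmetric])
  also have "(\<Sum>s<n. u s) = - (\<Sum>s<n. c (Suc s) * (1 - q ^ Suc s))"
    by (simp add: u_c sum_negf)
  also have "\<dots> = - (\<Sum>s\<le>n. c s * (1 - q ^ s))"
    by (simp only: tail_sum)
  finally have "(\<Sum>s\<le>n. c s * q ^ s - u s) = (\<Sum>s\<le>n. c s) - u n"
    by (simp add: algebra_simps sum_subtractf)
  moreover have "u n = (-1) ^ n * q ^ (Suc n * n + tri (Suc n))"
    by (simp add: u_def P_def)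
  moreover have "(\<Sum>s\<le>n. c s) = 1 + (\<Sum>k=1..n. (-1) ^ k * (q ^ (k * (k - 1) + tri k) + q ^ (k * k + tri k)))"
    using Suc by (simp add: c_def P_def)
  moreover have "(\<Sum>s\<le>n. (-1) ^ s * (\<Prod>i\<in>{s<..Suc n}. 1 - q ^ i) * q ^ (s * Suc n + tri s))
      = (\<Sum>s\<le>n. c s * q ^ s - u s)"
    by (intro sum.cong refl summand) simp
  ultimately show ?case
    unfolding sum.atMost_Suc by (simp add: algebra_simps)
qed auto

definition pent_sign :: "int \<Rightarrow> complex" where
  "pent_sign k = (-1) ^ nat \<bar>k\<bar>"

lemma sum_symmetric_int:
  fixes f :: "int \<Rightarrow> 'a::comm_monoid_add"
  shows "f 0 + (\<Sum>k=1..n. f (- int k) + f (int k)) = (\<Sum>k\<in>{- int n..int n}. f k)"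
proof (induction n)
  case (Suc n)
  have "{- int (Suc n)..int (Suc n)} = insert (- int (Suc n)) (insert (int (Suc n)) {- int n..int n})"
    by auto
  hence "(\<Sum>k\<in>{- int (Suc n)..int (Suc n)}. f k)
      = f (- int (Suc n)) + (f (int (Suc n)) + (f 0 + (\<Sum>k=1..n. f (- int k) + f (int k))))"
    using Suc by simp
  thus ?case by (simp add: add_ac)
qed simp

lemma abs_le_pent:
  fixes k :: int
  assumes "k * (3 * k + 1) = 2 * n"
  shows "\<bar>k\<bar> \<le> n"
proof (cases "k \<ge> 0")
  case True
  hence "k * 2 \<le> k * (3 * k + 1)" 
    by (cases "k = 0") (auto intro!: mult_left_mono)
  thus ?thesis using True assms by simp
next
  case False
  hence "(-k) * 2 \<le> (-k) * (- 3 * k - 1)" by (intro mult_left_mono) auto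
  thus ?thesis using False assms by (simp add: algebra_simps)
qed

text \<open>An exponent is \<open>n = k (3k + 1) / 2\<close> exactly if \<open>(6k + 1)\<^sup>2 = 24 n + 1\<close>. In this form the residues modulo \<open>7\<close>
  can be read off from the squares modulo \<open>7\<close>, and multiplication of \<open>6k + 1\<close> by \<open>7\<close> becomes visible.\<close>

theorem pentagonal_number_theorem:
  "euler 1 $ n = (\<Sum>k | (6 * k + 1) ^ 2 = 24 * int n + 1. pent_sign k)"
proof -
  define f where "f = (\<lambda>k::int. fps_const (pent_sign k) * q ^ nat (k * (3 * k + 1) div 2))"
  have exp_pos: "nat (int k * (3 * int k + 1) div 2) = k * k + tri k" for k
  proof -
    have "int k * (3 * int k + 1) = 2 * int (k * k + tri k)"
      using arg_cong[OF tri_double[of k], of int] by (simp add: algebra_simps)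
    thus ?thesis by (simp del: of_nat_add of_nat_mult)
  qed
  have exp_neg: "nat ((- int k) * (3 * (- int k) + 1) div 2) = k * (k - 1) + tri k" if "k \<ge> 1" for k
  proof -
    have "(- int k) * (3 * (- int k) + 1) = 2 * int (k * (k - 1) + tri k)"
      using arg_cong[OF tri_double[of k], of int] that by (cases k) (simp_all add: algebra_simps)
    thus ?thesis by (simp del: of_nat_add of_nat_mult)
  qed
  have sgn_eq: "fps_const (pent_sign (int k)) = (-1) ^ k" "fps_const (pent_sign (- int k)) = (-1) ^ k" for k
    by (simp_all add: pent_sign_def fps_const_power[symmetric] fps_const_neg[symmetric] del: fps_const_power fps_const_neg)
  have f_pos: "f (int k) = (-1) ^ k * q ^ (k * k + tri k)" for k
    unfolding f_def exp_pos sgn_eq ..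
  have f_neg: "f (- int k) = (-1) ^ k * q ^ (k * (k - 1) + tri k)" if "k \<ge> 1" for k
    unfolding f_def exp_neg[OF that] sgn_eq ..
  have "euler 1 $ n = (\<Prod>i\<in>{0<..n}. 1 - q ^ i) $ n"
    by (simp add: euler_def qpoch_def atLeastSucAtMost_greaterThanAtMost[symmetric])
  also have "\<dots> = (\<Sum>s\<le>n. (-1) ^ s * (\<Prod>i\<in>{s<..n}. 1 - q ^ i) * q ^ (s * n + tri s)) $ n"
  proof -
    have "((-1) ^ s * (\<Prod>i\<in>{s<..n}. 1 - q ^ i) * q ^ (s * n + tri s)) $ n = 0" if "s \<noteq> 0" for s
    proof -
      have "s * n + tri s > n" using that by (cases s) auto
      thus ?thesis by (simp add: fps_X_power_mult_right_nth)
    qed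
    hence "(\<Sum>s\<le>n. ((-1) ^ s * (\<Prod>i\<in>{s<..n}. 1 - q ^ i) * q ^ (s * n + tri s)) $ n)
        = (\<Sum>s\<in>{0}. ((-1) ^ s * (\<Prod>i\<in>{s<..n}. 1 - q ^ i) * q ^ (s * n + tri s)) $ n)"
      by (intro sum.mono_neutral_right) auto
    thus ?thesis by (simp add: fps_sum_nth)
  qed
  also have "\<dots> = (f 0 + (\<Sum>k=1..n. f (- int k) + f (int k))) $ n"
  proof -
    have "(\<Sum>k=1..n. (-1) ^ k * (q ^ (k * (k - 1) + tri k) + q ^ (k * k + tri k)))
        = (\<Sum>k=1..n. f (- int k) + f (int k))"
      by (intro sum.cong refl) (simp only: f_pos f_neg ring_distribs atLeastAtMost_iff)
    moreover have "f 0 = 1" using f_pos[of 0] by simp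
    ultimately show ?thesis unfolding Shanks_identity by simp
  qed
  also have "\<dots> = (\<Sum>k\<in>{- int n..int n}. f k) $ n"
    by (simp only: sum_symmetric_int)
  also have "\<dots> = (\<Sum>k\<in>{- int n..int n}. if (6 * k + 1) ^ 2 = 24 * int n + 1 then pent_sign k else 0)"
    unfolding fps_sum_nth
  proof (intro sum.cong refl)
    fix k :: int
    have ipoly: "even (k * (3 * k + 1))" by simp
    have nn: "k * (3 * k + 1) \<ge> 0" 
      by (cases "k \<ge> 0") (auto simp: zero_le_mult_iff)
    have "(6 * k + 1) ^ 2 = 12 * (k * (3 * k + 1)) + 1" by (simp add: power2_eq_square algebra_simps)
    hence "(6 * k + 1) ^ 2 = 24 * int n + 1 \<longleftrightarrow> nat (k * (3 * k + 1) div 2) = n"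
      using ipoly nn by (auto elim!: evenE)
    thus "f k $ n = (if (6 * k + 1) ^ 2 = 24 * int n + 1 then pent_sign k else 0)"
      by (auto simp: f_def)
  qed
  also have "\<dots> = (\<Sum>k | (6 * k + 1) ^ 2 = 24 * int n + 1. pent_sign k)"
  proof -
    have "\<bar>k\<bar> \<le> int n" if "(6 * k + 1) ^ 2 = 24 * int n + 1" for k
      using that by (intro abs_le_pent) (simp add: power2_eq_square algebra_simps)
    hence "{k. (6 * k + 1) ^ 2 = 24 * int n + 1} = {k\<in>{- int n..int n}. (6 * k + 1) ^ 2 = 24 * int n + 1}"
      by (auto simp only: abs_le_iff atLeastAtMost_iff mem_Collect_eq minus_le_iff)
    thus ?thesis by (simp only: sum.inter_filter[OF finite_atLeastAtMost_int])
  qed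
  finally show ?thesis .
qed

section \<open>Jacobi's series for the cube of the Euler product\<close>

lemma tri_square: "(2 * k + 1) ^ 2 = 8 * tri k + 1"
  using tri_double[of k] by (simp add: power2_eq_square algebra_simps)

lemma le_tri: "k \<le> tri k"
  by (induction k) auto

lemma eq_upto_inverse:
  assumes "eq_upto n f g" "f $ 0 = 1" "g $ 0 = 1"
  shows "eq_upto n (inverse f) (inverse g)"
proof -
  have "eq_upto n (inverse f * inverse g * g) (inverse f * inverse g * f)"
    using assms(1) by (intro eq_upto_mult) (auto intro: eq_upto_sym)
  moreover have "inverse f * inverse g * g = inverse f"
    using assms by (simp add: mult.assoc inverse_mult_eq_1)
  moreover have "inverse f * inverse g * f = inverse g"
    using assms by (simp add: mult.commute mult.left_commute inverse_mult_eq_1 inverse_mult_eq_1')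
  ultimately show ?thesis by simp
qed

abbreviation Q :: "nat \<Rightarrow> complex fps" where "Q \<equiv> qpoch 1"

text \<open>The coefficient of \<open>z\<^sup>k\<close>, \<open>k \<ge> 0\<close>, in the finite Jacobi triple product
  \<open>(1 - 1/z) \<Prod> (1 - z q\<^sup>i) (1 - q\<^sup>i / z)\<close>, \<open>1 \<le> i \<le> n\<close>; the quotient is a Gaussian binomial coefficient. The coefficients
  at \<open>k\<close> and \<open>- 1 - k\<close> are opposite, so that the derivative at \<open>z = 1\<close> is the sum over \<open>k \<ge> 0\<close> weighted by \<open>2k + 1\<close>.\<close>

definition jacobi_term :: "nat \<Rightarrow> nat \<Rightarrow> complex fps" where
  "jacobi_term n k = (if k \<le> n
     then (-1) ^ k * q ^ tri k * Q (2 * n + 1) * inverse (Q (n - k)) * inverse (Q (n + k + 1)) else 0)"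

lemma inverse_Q: "inverse (Q m) = (1 - q ^ Suc m) * inverse (Q (Suc m))"
proof -
  have "(1 - q ^ Suc m) * inverse (1 - q ^ Suc m) = 1"
    by (rule inverse_mult_eq_1') simp
  thus ?thesis by (simp add: qpoch_Suc fps_inverse_mult del: power_Suc)
qed

text \<open>The common factor of the terms for \<open>n\<close> and \<open>n + 1\<close> around \<open>k\<close>. All of them become polynomial multiples
  of it, so that the recursion in \<open>n\<close> is reduced to a polynomial identity.\<close>

definition jacobi_factor :: "nat \<Rightarrow> nat \<Rightarrow> complex fps" where
  "jacobi_factor n k = Q (2 * n + 1) * inverse (Q (n + 1 - k)) * inverse (Q (n + k + 2))"

lemma jacobi_in_terms_of_factor:
  assumes "k \<le> n + 1"
  defines "y \<equiv> q ^ k" and "u \<equiv> q ^ (n + 1 - k)"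
  shows "jacobi_term n k = (-1) ^ k * q ^ tri k * (1 - u) * (1 - q * y\<^sup>2 * u) * jacobi_factor n k"
    and "jacobi_term (n + 1) k = (-1) ^ k * q ^ tri k * (1 - y\<^sup>2 * u\<^sup>2) * (1 - q * y\<^sup>2 * u\<^sup>2) * jacobi_factor n k"
    and "jacobi_term n (k + 1) = (-1) ^ (k + 1) * q ^ tri k * y * (1 - u) * (q - u) * jacobi_factor n k"
    and "Q (2 * n + 1) * inverse (Q (n + 1 - k)) * inverse (Q (n + k))
         = (1 - y\<^sup>2 * u) * (1 - q * y\<^sup>2 * u) * jacobi_factor n k"
proof -
  obtain m where n: "n + 1 = k + m" using assms(1) le_Suc_ex by metis
  have u: "u = q ^ m" using n by (simp add: u_def)
  have p1: "q ^ (n + k + 1) = y\<^sup>2 * u"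
  proof -
    have "n + k + 1 = k * 2 + m" using n by simp
    thus ?thesis by (simp only: y_def u power_add power_mult)
  qed
  have p2: "q ^ Suc (n + k + 1) = q * y\<^sup>2 * u"
    using p1 by (simp add: mult_ac)
  have p3: "q ^ (2 * n + 2) = y\<^sup>2 * u\<^sup>2"
  proof -
    have "2 * n + 2 = k * 2 + m * 2" using n by simp
    thus ?thesis by (simp only: y_def u power_add power_mult)
  qed
  have i1: "inverse (Q (n + k + 1)) = (1 - q * y\<^sup>2 * u) * inverse (Q (n + k + 2))"
    using inverse_Q[of "n + k + 1"] unfolding p2 by simp
  have i2: "inverse (Q (n + k)) = (1 - y\<^sup>2 * u) * (1 - q * y\<^sup>2 * u) * inverse (Q (n + k + 2))"
    using inverse_Q[of "n + k"] i1 p1 by (simp add: mult_ac)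
  show "Q (2 * n + 1) * inverse (Q (n + 1 - k)) * inverse (Q (n + k))
         = (1 - y\<^sup>2 * u) * (1 - q * y\<^sup>2 * u) * jacobi_factor n k"
    unfolding i2 jacobi_factor_def by (simp only: mult_ac)
  show "jacobi_term n k = (-1) ^ k * q ^ tri k * (1 - u) * (1 - q * y\<^sup>2 * u) * jacobi_factor n k"
  proof (cases "k \<le> n")
    case True
    have "inverse (Q (n - k)) = (1 - u) * inverse (Q (n + 1 - k))"
      using inverse_Q[of "n - k"] True by (simp add: u_def Suc_diff_le)
    thus ?thesis using True i1 by (simp add: jacobi_term_def jacobi_factor_def mult_ac)
  next
    case False
    hence "u = 1" using assms(1) by (simp add: u_def)
    thus ?thesis using False by (simp add: jacobi_term_def)
  qed
  show "jacobi_term (n + 1) k = (-1) ^ k * q ^ tri k * (1 - y\<^sup>2 * u\<^sup>2) * (1 - q * y\<^sup>2 * u\<^sup>2) * jacobi_factor n k"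
  proof -
    have "Q (2 * (n + 1) + 1) = Q (2 * n + 1) * (1 - q ^ (2 * n + 2)) * (1 - q * q ^ (2 * n + 2))"
      by (simp add: qpoch_Suc)
    thus ?thesis using assms(1) unfolding p3 by (simp add: jacobi_term_def jacobi_factor_def mult_ac)
  qed
  \<comment> \<open>For \<open>k = n\<close> and \<open>k = n + 1\<close> the term is zero by definition, and so is \<open>(1 - u) * (q - u)\<close>.\<close>
  show "jacobi_term n (k + 1) = (-1) ^ (k + 1) * q ^ tri k * y * (1 - u) * (q - u) * jacobi_factor n k"
  proof (cases m)
    case 0
    thus ?thesis using u n by (simp add: jacobi_term_def)
  next
    case (Suc l)
    show ?thesis
    proof (cases l)
      case 0
      hence "u = q" using Suc u by simp
      thus ?thesis using 0 Suc n by (simp add: jacobi_term_def)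
    next
      case (Suc j)
      have m: "m = Suc (Suc j)" using Suc \<open>m = Suc l\<close> by simp
      have a: "n - (k + 1) = j" "n + 1 - k = Suc (Suc j)" "k + 1 \<le> n" using n m by simp_all
      have "inverse (Q j) = (1 - q ^ Suc j) * (1 - u) * inverse (Q (Suc (Suc j)))"
        using inverse_Q[of j] inverse_Q[of "Suc j"] by (simp add: u m mult_ac)
      moreover have "q * (1 - q ^ Suc j) = q - u"
        by (simp add: u m algebra_simps)
      ultimately have "q * inverse (Q j) = (q - u) * (1 - u) * inverse (Q (Suc (Suc j)))"
        by (simp only: mult.assoc[symmetric])
      moreover have "q ^ tri (k + 1) = q ^ tri k * y * q"
        by (simp add: y_def power_add mult_ac)
      ultimately show ?thesis using a by (simp add: jacobi_term_def jacobi_factor_def mult_ac)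
    qed
  qed
qed

text \<open>This is multiplication by \<open>(1 - z q\<^bsup>n+1\<^esup>) (1 - q\<^bsup>n+1\<^esup> / z)\<close>, read off at \<open>z\<^sup>k\<close>.\<close>

lemma jacobi_rec_Suc:
  assumes "k \<le> n"
  shows "jacobi_term (n + 1) (Suc k) = (1 + q ^ (2 * n + 2)) * jacobi_term n (Suc k)
           - q ^ (n + 1) * (jacobi_term n k + jacobi_term n (Suc k + 1))"
proof -
  define y u where "y = q ^ Suc k" and "u = q ^ (n + 1 - Suc k)"
  have le: "Suc k \<le> n + 1" using assms by simp
  note eqs = jacobi_in_terms_of_factor[OF le, folded y_def u_def]
  have yu: "q ^ (n + 1) = y * u"
    using assms by (simp add: y_def u_def power_add[symmetric])
  have yu2: "q ^ (2 * n + 2) = y\<^sup>2 * u\<^sup>2"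
  proof -
    have "2 * n + 2 = (n + 1) * 2" by simp
    thus ?thesis by (simp only: power_mult yu power_mult_distrib)
  qed
  have jk: "jacobi_term n k = (-1) ^ k * q ^ tri k * ((1 - y\<^sup>2 * u) * (1 - q * y\<^sup>2 * u) * jacobi_factor n (Suc k))"
    unfolding eqs(4)[symmetric] using assms by (simp add: jacobi_term_def mult_ac)
  have tk: "q ^ tri (Suc k) = q ^ tri k * y"
    by (simp add: y_def power_add)
  show ?thesis
    unfolding eqs(1,2,3) jk yu yu2 tk power_Suc[of "-1"] power_add[of "-1"]
    by (simp add: algebra_simps power2_eq_square)
qed

text \<open>The coefficient at \<open>-1\<close>, which the general recursion would ask for, is minus the one at \<open>0\<close> by antisymmetry.\<close>

lemma jacobi_rec_0:
  "jacobi_term (n + 1) 0 = (1 + q ^ (2 * n + 2)) * jacobi_term n 0 - q ^ (n + 1) * (jacobi_term n 1 - jacobi_term n 0)"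
proof -
  define u where "u = q ^ (n + 1)"
  have n: "2 * n + 2 = (n + 1) * 2" by simp
  have u: "q ^ (n + 1) = u" "q ^ (2 * n + 2) = u\<^sup>2"
    unfolding n by (simp_all only: u_def power_mult)
  have j0: "jacobi_term n 0 = (1 - u) * (1 - q * u) * jacobi_factor n 0"
    using jacobi_in_terms_of_factor(1)[of 0 n] by (simp add: u_def)
  have j0': "jacobi_term n 0 = Q (2 * n + 1) * inverse (Q (n + 1 - 0)) * inverse (Q (n + 0))"
    by (simp add: jacobi_term_def mult_ac)
  have j1: "jacobi_term n 1 = - (1 - u) * (q - u) * jacobi_factor n 0"
    using jacobi_in_terms_of_factor(3)[of 0 n] by (simp add: u_def)
  have j2: "jacobi_term (n + 1) 0 = (1 - u\<^sup>2) * (1 - q * u\<^sup>2) * jacobi_factor n 0"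
    using jacobi_in_terms_of_factor(2)[of 0 n] by (simp add: u_def)
  show ?thesis unfolding u j0 j1 j2
    by (simp add: algebra_simps power2_eq_square)
qed

text \<open>Weighting by \<open>2k + 1\<close> makes the two shifted sums in the recursion add up to twice the unshifted one: the sum
  is multiplied by \<open>1 - 2 q\<^bsup>n+1\<^esup> + q\<^bsup>2n+2\<^esup>\<close> in each step.\<close>

lemma sum_jacobi_term: "(\<Sum>k\<le>n. of_nat (2 * k + 1) * jacobi_term n k) = (Q n)\<^sup>2"
proof (induction n)
  case 0
  have "inverse (1 - q) * (1 - q) = 1" by (rule inverse_mult_eq_1) simp
  thus ?case by (simp add: jacobi_term_def qpoch_Suc mult.commute)
next
  case (Suc n)
  define j where "j = jacobi_term n"
  define Z where "Z = (\<Sum>k\<le>n. of_nat (2 * k + 1) * j k)"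
  \<comment> \<open>The coefficient at \<open>k - 1\<close>, also for \<open>k = 0\<close>.\<close>
  define prev where "prev = (\<lambda>k. case k of 0 \<Rightarrow> - j 0 | Suc i \<Rightarrow> j i)"
  have [simp]: "j (Suc n) = 0" "j (Suc (Suc n)) = 0"
    by (simp_all add: j_def jacobi_term_def)
  have rec: "jacobi_term (Suc n) k = (1 + q ^ (2 * n + 2)) * j k - q ^ (n + 1) * (prev k + j (Suc k))"
    if "k \<le> Suc n" for k
    using jacobi_rec_0[of n] jacobi_rec_Suc[of "k - 1" n] that
    by (cases k) (simp_all add: prev_def j_def)
  have 1: "(\<Sum>k\<le>Suc n. of_nat (2 * k + 1) * j k) = Z"
    by (simp add: Z_def)
  have 2: "(\<Sum>k\<le>Suc n. of_nat (2 * k + 1) * prev k) = - j 0 + (\<Sum>k\<le>n. of_nat (2 * k + 3) * j k)"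
    unfolding sum.atMost_Suc_shift by (simp add: prev_def add.commute)
  have 3: "(\<Sum>k\<le>Suc n. of_nat (2 * k + 1) * j (Suc k)) = j 0 + (\<Sum>k\<le>n. (of_nat (2 * k) - 1) * j k)"
  proof -
    have "(\<Sum>k\<le>Suc (Suc n). (of_nat (2 * k) - 1) * j k)
        = - j 0 + (\<Sum>k\<le>Suc n. of_nat (2 * k + 1) * j (Suc k))"
      unfolding sum.atMost_Suc_shift[of _ "Suc n"] by simp
    thus ?thesis by simp
  qed
  have cancel: "a + b = z" if "a = - c + x" "b = c + y" "x + y = z" for a b c x y z :: "complex fps"
    using that by simp
  have 4: "(\<Sum>k\<le>n. of_nat (2 * k + 3) * j k) + (\<Sum>k\<le>n. (of_nat (2 * k) - 1) * j k) = 2 * Z"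
    unfolding Z_def sum.distrib[symmetric] sum_distrib_left by (intro sum.cong) (auto simp: algebra_simps)
  have "(\<Sum>k\<le>Suc n. of_nat (2 * k + 1) * jacobi_term (Suc n) k)
      = (\<Sum>k\<le>Suc n. (1 + q ^ (2 * n + 2)) * (of_nat (2 * k + 1) * j k)
           - q ^ (n + 1) * (of_nat (2 * k + 1) * prev k + of_nat (2 * k + 1) * j (Suc k)))"
    by (intro sum.cong refl) (simp add: rec algebra_simps del: sum.atMost_Suc)
  also have "\<dots> = (1 + q ^ (2 * n + 2)) * (\<Sum>k\<le>Suc n. of_nat (2 * k + 1) * j k)
      - q ^ (n + 1) * ((\<Sum>k\<le>Suc n. of_nat (2 * k + 1) * prev k)
                     + (\<Sum>k\<le>Suc n. of_nat (2 * k + 1) * j (Suc k)))"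
    by (simp only: sum_subtractf sum_distrib_left[symmetric] sum.distrib[symmetric])
  also have "\<dots> = (1 + q ^ (2 * n + 2)) * Z - q ^ (n + 1) * (2 * Z)"
    by (simp only: 1 cancel[OF 2 3 4])
  also have "\<dots> = Z * (1 - q ^ Suc n)\<^sup>2"
  proof -
    have "2 * n + 2 = (n + 1) * 2" by simp
    hence x: "q ^ (2 * n + 2) = (q ^ Suc n)\<^sup>2" by (simp only: power_mult Suc_eq_plus1)
    show ?thesis unfolding x Suc_eq_plus1 by (simp add: power2_eq_square algebra_simps del: power_Suc)
  qed
  also have "Z = (Q n)\<^sup>2" using Suc by (simp add: Z_def j_def)
  finally show ?case by (simp add: qpoch_Suc power_mult_distrib)
qed

text \<open>Multiplying the finite identity by \<open>E\<^sub>1\<close> cancels the Gaussian binomial in the limit and turns the square into a cube.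
  As for the pentagonal numbers, the triangular exponents are described by the squares \<open>(2k + 1)\<^sup>2 = 8 n + 1\<close>.\<close>

theorem Jacobi_cube_identity:
  "(euler 1 ^ 3) $ M = (\<Sum>k | (2 * k + 1) ^ 2 = 8 * M + 1. of_int ((-1) ^ k * (2 * int k + 1)))"
proof -
  \<comment> \<open>Large enough: a term with \<open>tri k \<le> M\<close> has \<open>k \<le> M \<le> n - k\<close>, so both denominators agree with \<open>E\<^sub>1\<close> up to degree \<open>M\<close>.\<close>
  define n where "n = 2 * M"
  have jacobi_limit: "eq_upto M (euler 1 * jacobi_term n k) ((-1) ^ k * q ^ tri k)" if k: "k \<le> n" for k
  proof -
    define c where "c = Q (2 * n + 1) * inverse (Q (n - k)) * inverse (Q (n + k + 1))"
    have eq: "euler 1 * jacobi_term n k = (-1) ^ k * q ^ tri k * (euler 1 * c)"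
      using k by (simp add: jacobi_term_def c_def mult_ac)
    show ?thesis
    proof (cases "tri k > M")
      case True
      thus ?thesis unfolding eq
        by (auto simp: eq_upto_def mult.assoc fps_X_power_mult_nth mult.left_commute[of "(-1)^k"] 
                       mult.commute[of "(-1)^k"])
    next
      case False
      hence "M \<le> n - k" using le_tri[of k] by (simp add: n_def)
      hence "eq_upto M (euler 1 * c) (euler 1 * (euler 1 * inverse (euler 1) * inverse (euler 1)))"
        unfolding c_def
        by (intro eq_upto_mult eq_upto_refl eq_upto_inverse eq_upto_sym[OF eq_upto_euler]) (auto simp: n_def)
      also have "euler 1 * (euler 1 * inverse (euler 1) * inverse (euler 1)) = (inverse (euler 1) * euler 1) * (inverse (euler 1) * euler 1)"
        by (simp only: mult_ac)
      also have "\<dots> = 1" by (simp add: inverse_mult_eq_1)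
      finally have "eq_upto M ((-1) ^ k * q ^ tri k * (euler 1 * c)) ((-1) ^ k * q ^ tri k * 1)"
        by (intro eq_upto_mult) auto
      thus ?thesis unfolding eq by simp
    qed
  qed
  have "eq_upto M (euler 1 * euler 1 ^ 2) (euler 1 * (Q n) ^ 2)"
    by (intro eq_upto_mult eq_upto_power eq_upto_euler) (auto simp: n_def)
  hence "(euler 1 ^ 3) $ M = (euler 1 * (Q n) ^ 2) $ M"
    by (simp add: eq_upto_def power3_eq_cube power2_eq_square mult.assoc)
  also have "\<dots> = (\<Sum>k\<le>n. of_nat (2 * k + 1) * (euler 1 * jacobi_term n k)) $ M"
    unfolding sum_jacobi_term[symmetric] sum_distrib_left by (simp only: mult.left_commute)
  also have "\<dots> = (\<Sum>k\<le>n. (of_nat (2 * k + 1) * ((-1) ^ k * q ^ tri k)) $ M)"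
    unfolding fps_sum_nth
  proof (intro sum.cong refl)
    fix k assume "k \<in> {..n}"
    hence "eq_upto M (of_nat (2 * k + 1) * (euler 1 * jacobi_term n k)) (of_nat (2 * k + 1) * ((-1) ^ k * q ^ tri k))"
      by (intro eq_upto_mult jacobi_limit) auto
    thus "(of_nat (2 * k + 1) * (euler 1 * jacobi_term n k)) $ M = (of_nat (2 * k + 1) * ((-1) ^ k * q ^ tri k)) $ M"
      by (simp add: eq_upto_def)
  qed
  also have "\<dots> = (\<Sum>k\<le>n. if (2 * k + 1) ^ 2 = 8 * M + 1 then of_int ((-1) ^ k * (2 * int k + 1)) else 0)"
  proof (intro sum.cong refl)
    fix k
    have "(-1 :: complex fps) ^ k = fps_const ((-1) ^ k)"
      by (simp flip: fps_const_power fps_const_neg)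
    moreover have "(of_nat (2 * k + 1) :: complex fps) = fps_const (of_nat (2 * k + 1))"
      by (simp only: fps_of_nat)
    ultimately have "of_nat (2 * k + 1) * ((-1) ^ k * q ^ tri k)
        = fps_const (of_int ((-1) ^ k * (2 * int k + 1))) * q ^ tri k"
      by (simp only: mult.assoc[symmetric] fps_const_mult) (simp add: algebra_simps)
    moreover have "(2 * k + 1) ^ 2 = 8 * M + 1 \<longleftrightarrow> tri k = M"
      unfolding tri_square by simp
    ultimately show "(of_nat (2 * k + 1) * ((-1) ^ k * q ^ tri k)) $ M =
        (if (2 * k + 1) ^ 2 = 8 * M + 1 then of_int ((-1) ^ k * (2 * int k + 1)) else 0)"
      by (simp only: fps_mult_left_const_nth fps_X_power_nth) simp
  qed
  also have "\<dots> = (\<Sum>k\<in>{k\<in>{..n}. (2 * k + 1) ^ 2 = 8 * M + 1}. of_int ((-1) ^ k * (2 * int k + 1)))"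
    by (rule sum.inter_filter[symmetric]) simp
  also have "{k\<in>{..n}. (2 * k + 1) ^ 2 = 8 * M + 1} = {k. (2 * k + 1) ^ 2 = 8 * M + 1}"
  proof -
    have "k \<le> n" if "(2 * k + 1) ^ 2 = 8 * M + 1" for k
      using that le_tri[of k] unfolding tri_square n_def by simp
    thus ?thesis by auto
  qed
  finally show ?thesis .
qed

section \<open>The dissection of the Euler product modulo 7\<close>

definition res :: "nat \<Rightarrow> complex fps \<Rightarrow> complex fps" where
  "res r g = Abs_fps (\<lambda>n. if n mod 7 = r then g $ n else 0)"

text \<open>Grading of power series by the residues of the exponents modulo \<open>7\<close>; the grade \<open>r\<close> is itself meant modulo \<open>7\<close>.\<close>

definition graded :: "nat \<Rightarrow> complex fps \<Rightarrow> bool" where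
  "graded r g \<longleftrightarrow> (\<forall>n. g $ n \<noteq> 0 \<longrightarrow> n mod 7 = r mod 7)"

lemma graded_res: "graded r (res r g)"
  by (auto simp: graded_def res_def)

lemma graded_add: "graded r g \<Longrightarrow> graded r h \<Longrightarrow> graded r (g + h)"
  by (auto simp: graded_def) (metis add_0)

lemma graded_uminus: "graded r g \<Longrightarrow> graded r (- g)"
  by (auto simp: graded_def)

lemma graded_diff: "graded r g \<Longrightarrow> graded r h \<Longrightarrow> graded r (g - h)"
  using graded_add[of r g "- h"] graded_uminus[of r h] by simp

lemma graded_mult:
  assumes "graded r g" "graded s h"
  shows "graded (r + s) (g * h)"
  unfolding graded_def
proof (intro allI impI)
  fix n assume "(g * h) $ n \<noteq> 0"
  then obtain i where i: "i \<le> n" "g $ i \<noteq> 0" "h $ (n - i) \<noteq> 0"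
    unfolding fps_mult_nth by (metis (no_types, lifting) atLeastAtMost_iff mult_eq_0_iff sum.neutral)
  hence "i mod 7 = r mod 7" "(n - i) mod 7 = s mod 7"
    using assms by (auto simp: graded_def)
  hence "(i + (n - i)) mod 7 = (r + s) mod 7" by (metis mod_add_cong)
  thus "n mod 7 = (r + s) mod 7" using i by simp
qed

lemma graded_cong: "graded r g \<Longrightarrow> r mod 7 = s mod 7 \<Longrightarrow> graded s g"
  by (auto simp: graded_def)

lemma graded_numeral_mult: "graded r g \<Longrightarrow> graded r (numeral k * g)"
  by (auto simp: graded_def numeral_fps_const)

lemma res_graded:
  assumes "graded s g" "r < 7"
  shows "res r g = (if s mod 7 = r then g else 0)"
  using assms by (auto simp: graded_def res_def fps_eq_iff)

lemma res_add: "res r (g + h) = res r g + res r h"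
  by (auto simp: res_def fps_eq_iff)

lemma sum_res: "g = res 0 g + res 1 g + res 2 g + res 3 g + res 4 g + res 5 g + res 6 g"
proof (rule fps_ext)
  fix n :: nat
  have "n mod 7 < 7" by simp
  hence "n mod 7 \<in> {0,1,2,3,4,5,6}" by auto
  thus "g $ n = (res 0 g + res 1 g + res 2 g + res 3 g + res 4 g + res 5 g + res 6 g) $ n"
    by (auto simp: res_def)
qed

lemma square_mod_7: "(x::int)\<^sup>2 mod 7 \<in> {0, 1, 2, 4}"
proof -
  have "x mod 7 \<in> {0..<7}" by simp
  hence "x mod 7 \<in> {0,1,2,3,4,5,6}" by (auto simp del: mod_pos_pos_trivial)
  moreover have "x\<^sup>2 mod 7 = (x mod 7)\<^sup>2 mod 7" by (simp add: power_mod)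
  ultimately show ?thesis by auto
qed

text \<open>Applied to \<open>24 n + 1\<close> and \<open>8 n + 1\<close>: residue classes of exponents that would need a nonresidue modulo \<open>7\<close> do not occur.\<close>

lemma square_residue:
  assumes "(x::int)\<^sup>2 = c * int n + 1" "n mod 7 = r"
  shows "(c * int r + 1) mod 7 \<in> {0, 1, 2, 4}"
proof -
  have n: "n = r + 7 * (n div 7)"
    using assms(2) by (metis add.commute mult_div_mod_eq)
  have "x\<^sup>2 = (c * int r + 1) + 7 * (c * int (n div 7))"
    unfolding assms(1) by (subst n) (simp add: algebra_simps)
  hence "x\<^sup>2 mod 7 = (c * int r + 1) mod 7" by simp
  thus ?thesis using square_mod_7[of x] by simp
qed

lemma dvd_7_of_square: "(7::int) dvd x\<^sup>2 \<Longrightarrow> 7 dvd x"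
  using prime_dvd_power[of "7::int" x 2] by simp

text \<open>In these classes \<open>24 n + 1\<close> is not a square modulo \<open>7\<close>.\<close>

lemma res_euler_zero:
  assumes "r \<in> {3, 4, 6}"
  shows "res r (euler 1) = 0"
proof (rule fps_ext)
  fix n
  have "euler 1 $ n = 0" if "n mod 7 = r"
  proof -
    have "(6 * k + 1)\<^sup>2 \<noteq> 24 * int n + 1" for k
    proof
      assume "(6 * k + 1)\<^sup>2 = 24 * int n + 1"
      from square_residue[OF this that] show False using assms by auto
    qed
    thus ?thesis unfolding pentagonal_number_theorem by simp
  qed
  thus "res r (euler 1) $ n = 0 $ n" by (simp add: res_def)
qed

lemma euler49_nth: "euler 49 = euler 1 oo q ^ 49"
  using euler_dil[of 49 1] by simp

text \<open>In the class of \<open>2\<close> modulo \<open>7\<close> the number \<open>24 n + 1\<close> is divisible by \<open>7\<close>, hence \<open>6k + 1\<close> is \<open>7\<close> times a number of the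
  same form. Therefore the pentagonal series reproduces itself, dilated by \<open>49\<close>; the sign changes because
  \<open>k\<close> is replaced by \<open>7k + 1\<close>.\<close>

lemma res_euler_2: "res 2 (euler 1) = - (q\<^sup>2 * euler 49)"
proof (rule fps_ext)
  fix n
  show "res 2 (euler 1) $ n = (- (q\<^sup>2 * euler 49)) $ n"
  proof (cases "n mod 7 = 2")
    case False
    have "\<not> 49 dvd n - 2" if "n \<ge> 2"
    proof
      assume "49 dvd n - 2"
      then obtain m where "n - 2 = 49 * m" by blast
      hence "n = 49 * m + 2" using that by simp
      thus False using False by presburger
    qed
    thus ?thesis using False by (auto simp: res_def fps_X_power_mult_nth euler49_nth dil_nth)
  next
    case True
    then obtain m where n: "n = 7 * m + 2" by (metis mult_div_mod_eq)
    have k7: "\<exists>j. k = 7 * j + 1 \<and> 7 * (6 * j + 1)\<^sup>2 = 24 * int m + 7" if "(6 * k + 1)\<^sup>2 = 24 * int n + 1" for k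
    proof -
      have "7 dvd (6 * k + 1)\<^sup>2" unfolding that n by presburger
      hence "7 dvd 6 * k + 1" by (rule dvd_7_of_square)
      hence "k mod 7 = 1" by presburger
      then obtain j where "k = 7 * j + 1" by (metis mult_div_mod_eq)
      moreover from this that have "7 * (6 * j + 1)\<^sup>2 = 24 * int m + 7"
        by (simp add: n power2_eq_square algebra_simps)
      ultimately show ?thesis by blast
    qed
    have val: "(- (q\<^sup>2 * euler 49)) $ n = - (if 7 dvd m then euler 1 $ (m div 7) else 0)"
    proof -
      have "49 dvd 7 * m \<longleftrightarrow> 7 dvd m" by presburger
      moreover have "7 * m div 49 = m div 7" by presburger
      ultimately show ?thesis by (simp add: n fps_X_power_mult_nth euler49_nth dil_nth)
    qed
    have mult7_int: "7 dvd m" if "7 * x = 24 * int m + 7" for x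
      using that by presburger
    show ?thesis
    proof (cases "7 dvd m")
      case False
      have "(6 * k + 1)\<^sup>2 \<noteq> 24 * int n + 1" for k
        using k7[of k] mult7_int False by blast
      hence "euler 1 $ n = 0" unfolding pentagonal_number_theorem by simp
      thus ?thesis using val False True by (simp add: res_def)
    next
      case True
      then obtain l where m: "m = 7 * l" by blast
      have sq: "(6 * (7 * j + 1) + 1)\<^sup>2 = 49 * (6 * j + 1)\<^sup>2" for j :: int
        by (simp add: power2_eq_square algebra_simps)
      have sign: "pent_sign (7 * j + 1) = - pent_sign j" for j
      proof -
        have "even (nat \<bar>7 * j + 1\<bar>) \<longleftrightarrow> \<not> even (nat \<bar>j\<bar>)" by (simp add: even_nat_iff)
        thus ?thesis by (cases "even (nat \<bar>j\<bar>)") (simp_all add: pent_sign_def)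
      qed
      have "(\<Sum>j | (6 * j + 1)\<^sup>2 = 24 * int l + 1. - pent_sign j)
          = (\<Sum>k | (6 * k + 1)\<^sup>2 = 24 * int n + 1. pent_sign k)"
      proof (rule sum.reindex_bij_witness[where i = "\<lambda>k. (k - 1) div 7" and j = "\<lambda>j. 7 * j + 1"])
        fix k assume "k \<in> {k. (6 * k + 1)\<^sup>2 = 24 * int n + 1}"
        then obtain j where "k = 7 * j + 1" "7 * (6 * j + 1)\<^sup>2 = 24 * int m + 7" using k7 by auto
        thus "7 * ((k - 1) div 7) + 1 = k" "(k - 1) div 7 \<in> {j. (6 * j + 1)\<^sup>2 = 24 * int l + 1}"
          by (auto simp: m)
      next
        fix j assume "j \<in> {j. (6 * j + 1)\<^sup>2 = 24 * int l + 1}"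
        thus "7 * j + 1 \<in> {k. (6 * k + 1)\<^sup>2 = 24 * int n + 1}"
          unfolding mem_Collect_eq sq by (simp add: n m)
      qed (auto simp: sign)
      hence "euler 1 $ n = - euler 1 $ l"
        using pentagonal_number_theorem[of n] pentagonal_number_theorem[of l]
        by (simp add: sum_negf)
      thus ?thesis using val m \<open>n mod 7 = 2\<close> by (simp add: res_def)
    qed
  qed
qed

text \<open>In these classes \<open>8 n + 1\<close> is not a square modulo \<open>7\<close>.\<close>

lemma res_euler_cube_zero:
  assumes "r \<in> {2, 4, 5}"
  shows "res r (euler 1 ^ 3) = 0"
proof (rule fps_ext)
  fix n
  have "(euler 1 ^ 3) $ n = 0" if "n mod 7 = r"
  proof -
    have "(2 * k + 1)\<^sup>2 \<noteq> 8 * n + 1" for k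
    proof
      assume "(2 * k + 1)\<^sup>2 = 8 * n + 1"
      from arg_cong[OF this, of int] have "(2 * int k + 1)\<^sup>2 = 8 * int n + 1"
        by (simp add: add.commute)
      from square_residue[OF this that] show False using assms by auto
    qed
    thus ?thesis unfolding Jacobi_cube_identity by simp
  qed
  thus "res r (euler 1 ^ 3) $ n = 0 $ n" by (simp add: res_def)
qed

text \<open>The same self-similarity, now for \<open>8 n + 1\<close>. The factor \<open>7\<close> comes from the weight \<open>2k + 1\<close>.\<close>

lemma res_euler_cube_6: "res 6 (euler 1 ^ 3) = - 7 * (q\<^sup>2 * euler 49) ^ 3"
proof (rule fps_ext)
  fix n
  have euler49: "euler 49 ^ 3 = euler 1 ^ 3 oo q ^ 49"
    by (simp add: euler49_nth fps_compose_power)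
  have rhs: "(- 7 * (q\<^sup>2 * euler 49) ^ 3) $ n = - 7 * (q ^ 6 * (euler 49 ^ 3)) $ n"
    by (simp add: power_mult_distrib numeral_fps_const flip: power_mult)
  show "res 6 (euler 1 ^ 3) $ n = (- 7 * (q\<^sup>2 * euler 49) ^ 3) $ n"
  proof (cases "n mod 7 = 6")
    case False
    have "\<not> 49 dvd n - 6" if "n \<ge> 6"
    proof
      assume "49 dvd n - 6"
      then obtain m where "n - 6 = 49 * m" by blast
      hence "n = 49 * m + 6" using that by simp
      thus False using False by presburger
    qed
    thus ?thesis unfolding rhs using False
      by (auto simp: res_def fps_X_power_mult_nth euler49 dil_nth)
  next
    case True
    then obtain m where n: "n = 7 * m + 6" by (metis mult_div_mod_eq)
    have k7: "\<exists>j. k = 7 * j + 3 \<and> 7 * (2 * j + 1)\<^sup>2 = 8 * m + 7" if "(2 * k + 1)\<^sup>2 = 8 * n + 1" for k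
    proof -
      have "7 dvd (2 * k + 1)\<^sup>2" unfolding that n by presburger
      hence "7 dvd 2 * k + 1" using prime_dvd_power[of 7 "2 * k + 1" 2] by simp
      hence "k mod 7 = 3" by presburger
      then obtain j where "k = 7 * j + 3" by (metis mult_div_mod_eq)
      moreover from this that have "7 * (2 * j + 1)\<^sup>2 = 8 * m + 7"
        by (simp add: n power2_eq_square algebra_simps)
      ultimately show ?thesis by blast
    qed
    have val: "(- 7 * (q\<^sup>2 * euler 49) ^ 3) $ n = - 7 * (if 7 dvd m then (euler 1 ^ 3) $ (m div 7) else 0)"
    proof -
      have "49 dvd 7 * m \<longleftrightarrow> 7 dvd m" by presburger
      moreover have "7 * m div 49 = m div 7" by presburger
      ultimately show ?thesis unfolding rhs by (simp add: n fps_X_power_mult_nth euler49 dil_nth)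
    qed
    have mult7_nat: "7 dvd m" if "7 * x = 8 * m + 7" for x
      using that by presburger
    show ?thesis
    proof (cases "7 dvd m")
      case False
      have "(2 * k + 1)\<^sup>2 \<noteq> 8 * n + 1" for k
        using k7[of k] mult7_nat False by blast
      hence "(euler 1 ^ 3) $ n = 0" unfolding Jacobi_cube_identity by simp
      thus ?thesis using val False True by (simp add: res_def)
    next
      case True
      then obtain l where m: "m = 7 * l" by blast
      have sq: "(2 * (7 * j + 3) + 1)\<^sup>2 = 49 * (2 * j + 1)\<^sup>2" for j :: nat
        by (simp add: power2_eq_square algebra_simps)
      have "(\<Sum>j | (2 * j + 1)\<^sup>2 = 8 * l + 1. - 7 * complex_of_int ((-1) ^ j * (2 * int j + 1)))
          = (\<Sum>k | (2 * k + 1)\<^sup>2 = 8 * n + 1. complex_of_int ((-1) ^ k * (2 * int k + 1)))"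
      proof (rule sum.reindex_bij_witness[where i = "\<lambda>k. (k - 3) div 7" and j = "\<lambda>j. 7 * j + 3"])
        fix k assume "k \<in> {k. (2 * k + 1)\<^sup>2 = 8 * n + 1}"
        then obtain j where "k = 7 * j + 3" "7 * (2 * j + 1)\<^sup>2 = 8 * m + 7" using k7 by auto
        thus "7 * ((k - 3) div 7) + 3 = k" "(k - 3) div 7 \<in> {j. (2 * j + 1)\<^sup>2 = 8 * l + 1}"
          by (auto simp: m)
      next
        fix j assume "j \<in> {j. (2 * j + 1)\<^sup>2 = 8 * l + 1}"
        thus "7 * j + 3 \<in> {k. (2 * k + 1)\<^sup>2 = 8 * n + 1}"
          unfolding mem_Collect_eq sq by (simp add: n m)
      next
        fix j :: nat
        have "(-1 :: int) ^ (7 * j + 3) = - ((-1) ^ j)"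
          by (cases "even j") simp_all
        thus "complex_of_int ((-1) ^ (7 * j + 3) * (2 * int (7 * j + 3) + 1))
            = - 7 * complex_of_int ((-1) ^ j * (2 * int j + 1))"
          by (simp add: algebra_simps)
      qed auto
      hence "(euler 1 ^ 3) $ n = - 7 * (euler 1 ^ 3) $ l"
        unfolding Jacobi_cube_identity by (simp only: sum_distrib_left)
      thus ?thesis using val m \<open>n mod 7 = 6\<close> by (simp add: res_def)
    qed
  qed
qed

lemma cube_by_residue:
  fixes a b d e :: "'a::comm_ring_1"
  shows "(a + b + d - e) ^ 3 =
     (a * a * a + 3 * (b * b * d) - 6 * (a * d * e))
   + (d * d * d + 3 * (a * a * b) - 6 * (b * d * e))
   + 3 * (a * b * b + d * e * e - a * a * e)
   + (b * b * b + 3 * (a * d * d) - 6 * (a * b * e))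
   + 3 * (b * d * d + a * e * e - b * b * e)
   + 3 * (a * a * d + b * e * e - d * d * e)
   + (6 * (a * b * d) - e * e * e)"
  by (simp add: algebra_simps power3_eq_cube)

lemma res_sum_graded:
  assumes "graded 0 g0" "graded 1 g1" "graded 2 g2" "graded 3 g3" "graded 4 g4" "graded 5 g5" "graded 6 g6"
  shows "res 2 (g0 + g1 + g2 + g3 + g4 + g5 + g6) = g2"
    and "res 4 (g0 + g1 + g2 + g3 + g4 + g5 + g6) = g4"
    and "res 5 (g0 + g1 + g2 + g3 + g4 + g5 + g6) = g5"
    and "res 6 (g0 + g1 + g2 + g3 + g4 + g5 + g6) = g6"
  by (simp_all add: res_add assms[THEN res_graded])

text \<open>In the expansion of \<open>(a + b + d - e)\<^sup>3\<close> each residue class that is empty for \<open>E\<^sub>1\<^sup>3\<close> contains just three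
  monomials, with coefficients \<open>3\<close> or \<open>- 3\<close>, which must therefore cancel. The class of \<open>6\<close> contains only
  \<open>6 a b d - e\<^sup>3\<close>, and Jacobi's series says that this is \<open>- 7 e\<^sup>3\<close>.\<close>

lemma dissection_relations:
  defines "a \<equiv> res 0 (euler 1)" and "b \<equiv> res 1 (euler 1)" and "d \<equiv> res 5 (euler 1)" and "e \<equiv> q\<^sup>2 * euler 49"
  shows "euler 1 = a + b + d - e"
    and "a * b * b + d * e * e = a * a * e"
    and "b * d * d + a * e * e = b * b * e"
    and "a * a * d + b * e * e = d * d * e"
    and "a * b * d = - (e * e * e)"
proof -
  show euler: "euler 1 = a + b + d - e"
    using sum_res[of "euler 1"] res_euler_zero[of 3] res_euler_zero[of 4] res_euler_zero[of 6] res_euler_2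
    by (simp add: a_def b_def d_def e_def algebra_simps)
  have g: "graded 0 a" "graded 1 b" "graded 5 d" "graded 2 e"
    using graded_uminus[OF graded_res[of 2 "euler 1"]] 
    unfolding a_def b_def d_def e_def res_euler_2 minus_minus by (intro graded_res | assumption)+
  have gm: "graded s (x * y * z)"
    if "graded i x" "graded j y" "graded k z" "(i + j + k) mod 7 = s mod 7" for i j k s x y z
    using graded_mult[OF graded_mult[OF that(1,2)] that(3)] that(4) by (rule graded_cong)
  have g0: "graded 0 (a * a * a + 3 * (b * b * d) - 6 * (a * d * e))"
    by (intro graded_add graded_diff graded_numeral_mult) (rule gm, (rule g)+, simp)+
  have g1: "graded 1 (d * d * d + 3 * (a * a * b) - 6 * (b * d * e))"
    by (intro graded_add graded_diff graded_numeral_mult) (rule gm, (rule g)+, simp)+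
  have g2: "graded 2 (3 * (a * b * b + d * e * e - a * a * e))"
    by (intro graded_add graded_diff graded_numeral_mult) (rule gm, (rule g)+, simp)+
  have g3: "graded 3 (b * b * b + 3 * (a * d * d) - 6 * (a * b * e))"
    by (intro graded_add graded_diff graded_numeral_mult) (rule gm, (rule g)+, simp)+
  have g4: "graded 4 (3 * (b * d * d + a * e * e - b * b * e))"
    by (intro graded_add graded_diff graded_numeral_mult) (rule gm, (rule g)+, simp)+
  have g5: "graded 5 (3 * (a * a * d + b * e * e - d * d * e))"
    by (intro graded_add graded_diff graded_numeral_mult) (rule gm, (rule g)+, simp)+
  have g6: "graded 6 (6 * (a * b * d) - e * e * e)"
    by (intro graded_add graded_diff graded_numeral_mult) (rule gm, (rule g)+, simp)+
  note parts = res_sum_graded[OF g0 g1 g2 g3 g4 g5 g6, folded cube_by_residue, folded euler]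
  have three: "x = y" if "3 * (x - y) = (0 :: complex fps)" for x y
    using that by simp
  have z: "res 2 (euler 1 ^ 3) = 0" "res 4 (euler 1 ^ 3) = 0" "res 5 (euler 1 ^ 3) = 0"
    by (rule res_euler_cube_zero, simp)+
  show "a * b * b + d * e * e = a * a * e"
    by (rule three) (use parts(1) z(1) in \<open>simp only:\<close>)
  show "b * d * d + a * e * e = b * b * e"
    by (rule three) (use parts(2) z(2) in \<open>simp only:\<close>)
  show "a * a * d + b * e * e = d * d * e"
    by (rule three) (use parts(3) z(3) in \<open>simp only:\<close>)
  have "6 * (a * b * d) - e * e * e = - 7 * e ^ 3"
    using parts(4) unfolding res_euler_cube_6 e_def by (rule sym)
  hence "6 * (a * b * d + e * e * e) = 0" by (simp add: algebra_simps power3_eq_cube)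
  moreover have "x = 0" if "6 * x = (0 :: complex fps)" for x
    using that by simp
  ultimately have "a * b * d + e * e * e = 0" by blast
  thus "a * b * d = - (e * e * e)" by (simp add: eq_neg_iff_add_eq_0)
qed

text \<open>The equation \<open>e * septic e T x = T\<^sup>2\<close> is the modular equation of degree \<open>7\<close> between \<open>x / e\<close> and \<open>T / e\<^sup>4\<close>, made
  homogeneous.\<close>

definition septic :: "'a::comm_ring_1 \<Rightarrow> 'a \<Rightarrow> 'a \<Rightarrow> 'a" where
  "septic e T x = x ^ 7 + 7 * e * x ^ 6 + 21 * e ^ 2 * x ^ 5 + 49 * e ^ 3 * x ^ 4
     + (147 * e ^ 4 + 7 * T) * x ^ 3 + (343 * e ^ 5 + 35 * e * T) * x ^ 2 + (343 * e ^ 6 + 49 * e ^ 2 * T) * x"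

text \<open>The hypotheses are invariant under the cyclic permutation of \<open>a, b, d\<close>, so one passes to symmetric functions. The
  elementary symmetric functions \<open>p\<close> and \<open>s\<close> (the third one is \<open>- e\<^sup>3\<close>) satisfy a single equation, quadratic in \<open>s\<close>: it defines
  an elliptic curve. Moreover \<open>T = A + B s\<close> is linear in \<open>s\<close>. Eliminating \<open>s\<close> gives a
  quadratic equation for \<open>T\<close> over the polynomials in \<open>p\<close> and \<open>e\<close>, and with \<open>p = x + e\<close> this is the claim.\<close>

lemma septic_identity:
  fixes a b d e :: "'a::idom"
  assumes "a * b * b + d * e * e = a * a * e"
    and "b * d * d + a * e * e = b * b * e"
    and "a * a * d + b * e * e = d * d * e"
    and "a * b * d = - (e * e * e)"
  defines "T \<equiv> - (a * a * a * b + b * b * b * d + d * d * d * a) - 8 * e ^ 4"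
  shows "e * septic e T (a + b + d - e) = T ^ 2"
proof -
  define p where "p = a + b + d"
  define s where "s = a * b + b * d + d * a"
  define B where "B = - (p ^ 2 + 5 * e * p + e ^ 2)"
  define A where "A = 2 * e * p ^ 3 - e ^ 2 * p ^ 2 - 4 * e ^ 3 * p - 11 * e ^ 4"
  define r where "r = a * b * d"
  have r: "r = - (e * e * e)" using assms(4) by (simp add: r_def)
  \<comment> \<open>Weighting the relations by \<open>a, b, d\<close> makes their sum symmetric.\<close>
  have rel: "a * (a * b * b + d * e * e - a * a * e) + b * (b * d * d + a * e * e - b * b * e)
      + d * (a * a * d + b * e * e - d * d * e) = 0"
    unfolding assms(1-3) by simp
  have "s ^ 2 + (3 * e * p + e ^ 2) * s - (e * p ^ 3 - 2 * e ^ 3 * p - 3 * e ^ 4)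
      = (a * (a * b * b + d * e * e - a * a * e) + b * (b * d * d + a * e * e - b * b * e)
         + d * (a * a * d + b * e * e - d * d * e)) + (2 * p + 3 * e) * (r + e * e * e)"
    unfolding p_def s_def r_def by algebra
  hence quad: "s ^ 2 + (3 * e * p + e ^ 2) * s = e * p ^ 3 - 2 * e ^ 3 * p - 3 * e ^ 4"
    unfolding rel r by simp
  define m where "m = a * b * b + b * d * d + a * a * d"
  have m: "m = e * p ^ 2 - 2 * e * s - p * e ^ 2"
  proof -
    have "m - (e * p ^ 2 - 2 * e * s - p * e ^ 2) = (a * b * b + d * e * e - a * a * e)
        + (b * d * d + a * e * e - b * b * e) + (a * a * d + b * e * e - d * d * e)"
      unfolding m_def p_def s_def by algebra
    thus ?thesis unfolding assms(1-3) by simp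
  qed
  have S: "a * a * a * b + b * b * b * d + d * d * d * a = (p * s - 3 * r - m) * p - s ^ 2 + r * p"
    unfolding p_def s_def r_def m_def by algebra
  have s2: "s ^ 2 = e * p ^ 3 - 2 * e ^ 3 * p - 3 * e ^ 4 - (3 * e * p + e ^ 2) * s"
    using quad by (simp add: algebra_simps)
  have T: "T = A + B * s"
    unfolding T_def S r m s2 A_def B_def by algebra
  have "T ^ 2 - e * septic e T (p - e)
      = B ^ 2 * (s ^ 2 + (3 * e * p + e ^ 2) * s - (e * p ^ 3 - 2 * e ^ 3 * p - 3 * e ^ 4))"
    unfolding T A_def B_def septic_def by algebra
  hence "T ^ 2 = e * septic e T (p - e)"
    unfolding quad by simp
  thus ?thesis unfolding p_def by (rule sym)
qed

section \<open>Conjugation by seventh roots of unity\<close>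

abbreviation \<mu>7 :: "complex set" where "\<mu>7 \<equiv> {z. z ^ 7 = 1}"

lemma card_\<mu>7: "card \<mu>7 = 7" and finite_\<mu>7 [simp]: "finite \<mu>7"
  using card_roots_unity_eq[of 7] finite_roots_unity[of 7] by auto

lemma power_root_eq_1:
  assumes "z ^ 7 = 1" "z ^ m = 1" "\<not> 7 dvd m"
  shows "z = (1 :: complex)"
proof -
  have "coprime m 7"
    using assms(3) prime_imp_coprime[of "7::nat" m] by (simp add: coprime_commute)
  moreover have "m \<noteq> 0" using assms(3) by (metis dvd_0_right)
  ultimately obtain x y where "m * x = 7 * y + 1"
    using bezout_nat[of m 7] by (auto simp: coprime_iff_gcd_eq_1)
  hence "z ^ (m * x) = z ^ (7 * y + 1)" by simp
  thus ?thesis using assms by (simp add: power_mult power_add)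
qed

lemma power_commuting_exponents: "(z ^ m) ^ n = (z ^ n) ^ m" for z :: "'a::monoid_mult"
  unfolding power_mult[symmetric] by (subst mult.commute) (rule refl)

lemma bij_power_\<mu>7:
  assumes "\<not> 7 dvd m"
  shows "bij_betw (\<lambda>z. z ^ m) \<mu>7 \<mu>7"
proof -
  have maps: "(\<lambda>z. z ^ m) ` \<mu>7 \<subseteq> \<mu>7"
  proof clarify
    fix z :: complex assume z: "z ^ 7 = 1"
    have "(z ^ m) ^ 7 = (z ^ 7) ^ m" by (rule power_commuting_exponents)
    thus "(z ^ m) ^ 7 = 1" by (simp only: z power_one)
  qed
  have "inj_on (\<lambda>z. z ^ m) \<mu>7"
  proof (rule inj_onI)
    fix z w :: complex assume zw: "z \<in> \<mu>7" "w \<in> \<mu>7" "z ^ m = w ^ m"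
    hence w: "w ^ 7 = 1" and z: "z ^ 7 = 1" by simp_all
    from w have nz: "w \<noteq> 0" by (metis power_0_left zero_neq_numeral zero_neq_one)
    have "(z / w) ^ 7 = 1" unfolding power_divide z w by simp
    moreover have "(z / w) ^ m = 1" unfolding power_divide zw(3) using nz by simp
    ultimately have "z / w = 1" by (rule power_root_eq_1[OF _ _ assms])
    thus "z = w" using nz by simp
  qed
  thus ?thesis unfolding bij_betw_def using maps by (simp add: endo_inj_surj)
qed

lemma sum_power_\<mu>7: "(\<Sum>z\<in>\<mu>7. z ^ n) = (if 7 dvd n then 7 else 0)"
proof (cases "7 dvd n")
  case True
  hence "(\<Sum>z\<in>\<mu>7. z ^ n) = (\<Sum>z\<in>\<mu>7. 1)"
    by (intro sum.cong) (auto elim!: dvdE simp: power_mult)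
  thus ?thesis using True card_\<mu>7 by simp
next
  case False
  have "(\<Sum>z\<in>\<mu>7. z ^ n) = (\<Sum>z\<in>\<mu>7. z)"
    by (rule sum.reindex_bij_betw[OF bij_power_\<mu>7[OF False], of "\<lambda>z. z"])
  thus ?thesis using False sum_roots_unity[of 7] by simp
qed

text \<open>Used three times with coefficients in a ring of power series, to turn knowledge of all conjugates into a factorization.\<close>

lemma monic_eq_prod_roots:
  fixes p :: "'a::idom poly"
  assumes "finite Z" "inj_on r Z" "degree p = card Z" "lead_coeff p = 1"
    and "\<And>z. z \<in> Z \<Longrightarrow> poly p (r z) = 0"
  shows "p = (\<Prod>z\<in>Z. [:- r z, 1:])"
proof (rule poly_eqI_degree_lead_coeff[where A = "r ` Z" and n = "card Z"])
  show "degree (\<Prod>z\<in>Z. [:- r z, 1:]) \<le> card Z"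
    using degree_prod_sum_le[OF assms(1), of "\<lambda>z. [:- r z, 1:]"] by simp
  show "card Z \<le> card (r ` Z)" using assms by (simp add: card_image)
  show "coeff p (card Z) = coeff (\<Prod>z\<in>Z. [:- r z, 1:]) (card Z)"
  proof -
    have "degree (\<Prod>z\<in>Z. [:- r z, 1:]) = card Z"
      by (subst degree_prod_eq_sum_degree) auto
    hence "coeff (\<Prod>z\<in>Z. [:- r z, 1:]) (card Z) = lead_coeff (\<Prod>z\<in>Z. [:- r z, 1:])" by simp
    also have "\<dots> = 1" by (simp add: lead_coeff_prod)
    finally show ?thesis using assms by simp
  qed
qed (use assms in \<open>auto simp: poly_prod prod_zero\<close>)

lemma prod_diff_\<mu>7:
  fixes x Y :: "complex fps"
  assumes "Y \<noteq> 0"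
  shows "(\<Prod>z\<in>\<mu>7. x - fps_const z * Y) = x ^ 7 - Y ^ 7"
proof -
  define p where "p = monom (1::complex fps) 7 + [:- (Y ^ 7):]"
  have deg: "degree p = 7"
    unfolding p_def by (subst degree_add_eq_left) (simp_all add: degree_monom_eq)
  have "p = (\<Prod>z\<in>\<mu>7. [:- (fps_const z * Y), 1:])"
  proof (rule monic_eq_prod_roots)
    show "inj_on (\<lambda>z. fps_const z * Y) \<mu>7"
    proof (rule inj_onI)
      fix z w assume "fps_const z * Y = fps_const w * Y"
      hence "fps_const z = fps_const w" using assms by simp
      hence "fps_const z $ 0 = fps_const w $ 0" by (rule arg_cong)
      thus "z = w" by simp
    qed
    show "lead_coeff p = 1" unfolding deg by (simp add: p_def coeff_pCons split: nat.splits)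
    show "poly p (fps_const z * Y) = 0" if "z \<in> \<mu>7" for z
      using that by (simp add: p_def poly_monom power_mult_distrib fps_const_power)
  qed (simp_all add: deg card_\<mu>7)
  hence "poly p x = (\<Prod>z\<in>\<mu>7. poly [:- (fps_const z * Y), 1:] x)"
    by (simp only: poly_prod)
  thus ?thesis by (simp add: p_def poly_monom)
qed

text \<open>The automorphism \<open>q \<mapsto> z q\<close>; for \<open>z\<^sup>7 = 1\<close> it is conjugation over the series in \<open>q\<^sup>7\<close>.\<close>

definition twist :: "complex \<Rightarrow> complex fps \<Rightarrow> complex fps" where
  "twist z g = g oo (fps_const z * q)"

lemma twist_nth: "twist z g $ n = z ^ n * g $ n"
  by (simp add: twist_def fps_compose_linear)

lemma twist_add: "twist z (f + g) = twist z f + twist z g"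
  by (simp add: twist_def fps_compose_add_distrib)

lemma twist_diff: "twist z (f - g) = twist z f - twist z g"
  by (simp add: twist_def fps_compose_sub_distrib)

lemma twist_mult: "twist z (f * g) = twist z f * twist z g"
  by (simp add: twist_def fps_compose_mult_distrib)

lemma twist_power: "twist z (f ^ n) = twist z f ^ n"
  by (simp add: twist_def fps_compose_power)

lemma twist_prod: "twist z (prod f A) = (\<Prod>x\<in>A. twist z (f x))"
  by (simp add: twist_def fps_compose_prod_distrib)

lemma twist_1 [simp]: "twist z 1 = 1"
  by (simp add: twist_def)

lemma twist_numeral [simp]: "twist z (numeral k) = numeral k"
  by (simp add: twist_def numeral_fps_const)

lemma twist_graded:
  assumes "z ^ 7 = 1" "graded r g"
  shows "twist z g = fps_const (z ^ r) * g"
proof (rule fps_ext)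
  fix n
  have "z ^ n = z ^ r" if "n mod 7 = r mod 7"
  proof -
    have red: "z ^ k = z ^ (k mod 7)" for k
    proof -
      have "z ^ k = z ^ (7 * (k div 7) + k mod 7)" by simp
      also have "\<dots> = z ^ (k mod 7)" using assms(1) by (simp only: power_add power_mult) simp
      finally show ?thesis .
    qed
    show ?thesis using red[of n] red[of r] that by simp
  qed
  thus "twist z g $ n = (fps_const (z ^ r) * g) $ n"
    using assms(2) by (cases "g $ n = 0") (auto simp: twist_nth graded_def)
qed

lemma eq_upto_twist: "eq_upto n f g \<Longrightarrow> eq_upto n (twist z f) (twist z g)"
  by (simp add: eq_upto_def twist_nth)

text \<open>If \<open>7\<close> does not divide \<open>m\<close>, then \<open>z \<mapsto> z\<^sup>m\<close> permutes the seventh roots of unity, and the factors are those of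
  \<open>1 - X\<^sup>7\<close> at \<open>X = q\<^sup>m\<close>.\<close>

lemma norm_factor:
  assumes "m \<ge> 1"
  shows "(\<Prod>z\<in>\<mu>7. 1 - fps_const (z ^ m) * q ^ m) = (if 7 dvd m then (1 - q ^ m) ^ 7 else 1 - q ^ (7 * m))"
proof (cases "7 dvd m")
  case True
  hence "(\<Prod>z\<in>\<mu>7. 1 - fps_const (z ^ m) * q ^ m) = (\<Prod>z\<in>\<mu>7. 1 - q ^ m)"
    by (intro prod.cong) (auto elim!: dvdE simp: power_mult)
  thus ?thesis using True card_\<mu>7 by simp
next
  case False
  have "(\<Prod>z\<in>\<mu>7. 1 - fps_const (z ^ m) * q ^ m) = (\<Prod>z\<in>\<mu>7. 1 - fps_const z * q ^ m)"
    by (rule prod.reindex_bij_betw[OF bij_power_\<mu>7[OF False], of "\<lambda>z. 1 - fps_const z * q ^ m"])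
  also have "\<dots> = 1 ^ 7 - (q ^ m) ^ 7" by (rule prod_diff_\<mu>7) simp
  also have "\<dots> = 1 - q ^ (7 * m)" by (simp add: mult.commute flip: power_mult)
  finally show ?thesis using False by simp
qed

text \<open>Factors \<open>1 - q\<^sup>7\<^sup>m\<close> with \<open>7 dvd m\<close> are missing on the left and are supplied by the product with step \<open>49\<close>. The
  truncations are chosen such that both sides agree exactly, so that induction over blocks of seven factors works.\<close>

lemma norm_qpoch:
  "(\<Prod>m=1..7*N. if 7 dvd m then (1 - q ^ m) ^ 7 else 1 - q ^ (7 * m)) * qpoch 49 N
   = qpoch 7 (7 * N) * qpoch 7 N ^ 7"
proof (induction N)
  case (Suc N)
  define G where "G = (\<lambda>n. \<Prod>m=1..n. if 7 dvd m then (1 - q ^ m) ^ 7 else 1 - q ^ (7 * m))"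
  have G_Suc: "G (Suc n) = G n * (if 7 dvd Suc n then (1 - q ^ Suc n) ^ 7 else 1 - q ^ (7 * Suc n))" for n
    by (simp add: G_def del: power_Suc)
  have seven: "7 * Suc N = Suc (Suc (Suc (Suc (Suc (Suc (Suc (7 * N)))))))" by simp
  define R where "R = (\<Prod>i=1..6. 1 - q ^ (7 * (7 * N + i)))"
  have R: "R = (1 - q ^ (7 * Suc (7 * N))) * (1 - q ^ (7 * Suc (Suc (7 * N)))) * (1 - q ^ (7 * Suc (Suc (Suc (7 * N)))))
     * (1 - q ^ (7 * Suc (Suc (Suc (Suc (7 * N)))))) * (1 - q ^ (7 * Suc (Suc (Suc (Suc (Suc (7 * N)))))))
     * (1 - q ^ (7 * Suc (Suc (Suc (Suc (Suc (Suc (7 * N))))))))"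
    by (simp add: R_def eval_nat_numeral(3) numeral_eq_Suc del: power_Suc mult_Suc_right)
  have "G (7 * Suc N) = G (7 * N) * R * (1 - q ^ (7 * Suc N)) ^ 7"
  proof -
    have "\<not> 7 dvd Suc (7 * N)" "\<not> 7 dvd Suc (Suc (7 * N))" "\<not> 7 dvd Suc (Suc (Suc (7 * N)))"
      "\<not> 7 dvd Suc (Suc (Suc (Suc (7 * N))))" "\<not> 7 dvd Suc (Suc (Suc (Suc (Suc (7 * N)))))"
      "\<not> 7 dvd Suc (Suc (Suc (Suc (Suc (Suc (7 * N))))))" "7 dvd Suc (Suc (Suc (Suc (Suc (Suc (Suc (7 * N)))))))"
      by presburger+
    thus ?thesis unfolding seven G_Suc R by (simp only: if_False if_True mult.assoc)
  qed
  moreover have "qpoch 7 (7 * Suc N) = qpoch 7 (7 * N) * R * (1 - q ^ (49 * Suc N))"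
  proof -
    have "7 * Suc (Suc (Suc (Suc (Suc (Suc (Suc (7 * N))))))) = 49 * Suc N" by simp
    thus ?thesis unfolding seven qpoch_Suc R by (simp only: mult.assoc)
  qed
  ultimately have "G (7 * Suc N) * qpoch 49 (Suc N)
      = (G (7 * N) * qpoch 49 N) * R * (1 - q ^ (7 * Suc N)) ^ 7 * (1 - q ^ (49 * Suc N))"
    by (simp only: qpoch_Suc mult_ac)
  also have "G (7 * N) * qpoch 49 N = qpoch 7 (7 * N) * qpoch 7 N ^ 7"
    using Suc by (simp only: G_def)
  also have "qpoch 7 (7 * N) * qpoch 7 N ^ 7 * R * (1 - q ^ (7 * Suc N)) ^ 7 * (1 - q ^ (49 * Suc N))
      = (qpoch 7 (7 * N) * R * (1 - q ^ (49 * Suc N))) * (qpoch 7 N * (1 - q ^ (7 * Suc N))) ^ 7"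
    by (simp only: power_mult_distrib mult_ac)
  also have "\<dots> = qpoch 7 (7 * Suc N) * qpoch 7 (Suc N) ^ 7"
    using \<open>qpoch 7 (7 * Suc N) = _\<close> by (simp only: qpoch_Suc)
  finally show ?case by (simp only: G_def)
qed simp

text \<open>Factors of index divisible by \<open>7\<close> are invariant under conjugation and enter with their seventh power; the other ones
  give the factors of \<open>E\<^sub>7\<close> of index prime to \<open>7\<close>.\<close>

lemma norm_euler: "(\<Prod>z\<in>\<mu>7. twist z (euler 1)) * euler 49 = euler 7 ^ 8"
proof (rule eq_uptoI_all)
  fix n
  have "eq_upto n ((\<Prod>z\<in>\<mu>7. twist z (euler 1)) * euler 49) ((\<Prod>z\<in>\<mu>7. twist z (qpoch 1 (7 * n))) * qpoch 49 n)"
    by (intro eq_upto_mult eq_upto_prod eq_upto_twist eq_upto_euler) auto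
  also have "(\<Prod>z\<in>\<mu>7. twist z (qpoch 1 (7 * n)))
      = (\<Prod>z\<in>\<mu>7. \<Prod>m=1..7*n. 1 - fps_const (z ^ m) * q ^ m)"
  proof (intro prod.cong refl)
    fix z
    have "twist z (q ^ m) = fps_const (z ^ m) * q ^ m" for m
      by (rule fps_ext) (simp add: twist_nth)
    thus "twist z (qpoch 1 (7 * n)) = (\<Prod>m=1..7*n. 1 - fps_const (z ^ m) * q ^ m)"
      by (simp add: qpoch_def twist_prod twist_diff)
  qed
  also have "\<dots> = (\<Prod>m=1..7*n. \<Prod>z\<in>\<mu>7. 1 - fps_const (z ^ m) * q ^ m)"
    by (rule prod.swap)
  also have "\<dots> = (\<Prod>m=1..7*n. if 7 dvd m then (1 - q ^ m) ^ 7 else 1 - q ^ (7 * m))"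
    by (intro prod.cong refl norm_factor) simp
  finally have 1: "eq_upto n ((\<Prod>z\<in>\<mu>7. twist z (euler 1)) * euler 49) (qpoch 7 (7 * n) * qpoch 7 n ^ 7)"
    unfolding norm_qpoch .
  have "eq_upto n (euler 7 * euler 7 ^ 7) (qpoch 7 (7 * n) * qpoch 7 n ^ 7)"
    by (intro eq_upto_mult eq_upto_power eq_upto_euler) auto
  hence 2: "eq_upto n (qpoch 7 (7 * n) * qpoch 7 n ^ 7) (euler 7 * euler 7 ^ 7)"
    by (rule eq_upto_sym)
  have 3: "euler 7 * euler 7 ^ 7 = euler 7 ^ 8" 
  proof -
    have "(8::nat) = Suc 7" by simp
    thus ?thesis by (simp only: power_Suc)
  qed
  show "eq_upto n ((\<Prod>z\<in>\<mu>7. twist z (euler 1)) * euler 49) (euler 7 ^ 8)"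
    using eq_upto_trans[OF 1 2] unfolding 3 .
qed

lemma twist_septic: "twist z (septic e T x) = septic (twist z e) (twist z T) (twist z x)"
  by (simp add: septic_def twist_add twist_mult twist_power)

text \<open>Conjugation multiplies \<open>e\<close> by \<open>z\<^sup>2\<close> and \<open>T\<close> by \<open>z\<close>. Measuring the conjugates of \<open>E\<^sub>1\<close> relative to \<open>z\<^sup>2\<close> makes
  them roots of one and the same polynomial.\<close>

lemma septic_scale:
  fixes c :: "'a::idom"
  assumes "c ^ 7 = 1"
  shows "septic (c ^ 2 * e) (c * T) (c ^ 2 * x) = septic e T x"
proof -
  have "septic (c ^ 2 * e) (c * T) (c ^ 2 * x) = (c ^ 7) ^ 2 * (x ^ 7 + 7 * e * x ^ 6 + 21 * e ^ 2 * x ^ 5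
     + 49 * e ^ 3 * x ^ 4 + 147 * e ^ 4 * x ^ 3 + 343 * e ^ 5 * x ^ 2 + 343 * e ^ 6 * x)
     + c ^ 7 * (7 * T * x ^ 3 + 35 * e * T * x ^ 2 + 49 * e ^ 2 * T * x)"
    unfolding septic_def by algebra
  also have "\<dots> = septic e T x"
    unfolding assms septic_def by (simp add: algebra_simps)
  finally show ?thesis .
qed

text \<open>By the septic identity, the seven normalized conjugates of \<open>E\<^sub>1\<close> are the roots of \<open>septic e T x - \<kappa>\<close>
  with \<open>e \<kappa> = T\<^sup>2\<close>, and they are distinct because their constant terms are. So \<open>\<kappa>\<close> is the norm of \<open>E\<^sub>1\<close>, which is
  \<open>E\<^sub>7\<^sup>8 / E\<^sub>4\<^sub>9\<close>. This determines \<open>T\<^sup>2\<close>, and the coefficient of \<open>q\<close> decides the sign.\<close>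

theorem modular_equation_euler:
  "q ^ 2 * euler 49 * septic (q ^ 2 * euler 49) (q * euler 7 ^ 4) (euler 1) = (q * euler 7 ^ 4) ^ 2"
proof -
  define a b d e where "a = res 0 (euler 1)" and "b = res 1 (euler 1)" and "d = res 5 (euler 1)"
    and "e = q\<^sup>2 * euler 49"
  define T where "T = - (a * a * a * b + b * b * b * d + d * d * d * a) - 8 * e ^ 4"
  define \<kappa> where "\<kappa> = septic e T (euler 1)"
  note rels = dissection_relations[folded a_def b_def d_def e_def]
  have \<kappa>: "e * \<kappa> = T ^ 2"
    using septic_identity[OF rels(2-5), folded T_def rels(1)] unfolding \<kappa>_def .
  have g: "graded 0 a" "graded 1 b" "graded 5 d" "graded 2 e"
    using graded_uminus[OF graded_res[of 2 "euler 1"]]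
    unfolding a_def b_def d_def e_def res_euler_2 minus_minus by (intro graded_res | assumption)+
  have gT: "graded 1 T"
  proof -
    have 4: "graded s (w * x * y * v)"
      if "graded i w" "graded j x" "graded k y" "graded l v" "(i + j + k + l) mod 7 = s mod 7"
      for i j k l s w x y v
      using graded_mult[OF graded_mult[OF graded_mult[OF that(1,2)] that(3)] that(4)] that(5)
      by (rule graded_cong)
    have e4: "e ^ 4 = e * e * e * e" by (simp add: power4_eq_xxxx mult.assoc)
    show ?thesis unfolding T_def e4
      by (intro graded_diff graded_uminus graded_add graded_numeral_mult) (rule 4, (rule g)+, simp)+
  qed
  \<comment> \<open>As \<open>z\<^sup>5 = z\<^sup>-\<^sup>2\<close> for the roots in question, this is the normalization by the conjugate of \<open>e\<close>.\<close>
  define \<eta> where "\<eta> = (\<lambda>z. fps_const (z ^ 5) * twist z (euler 1))"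
  have twist_\<eta>: "twist z (euler 1) = fps_const z ^ 2 * \<eta> z" if "z \<in> \<mu>7" for z
  proof -
    have "z ^ 2 * z ^ 5 = 1" using that by (simp flip: power_add)
    thus ?thesis by (simp add: \<eta>_def mult.assoc[symmetric] fps_const_power)
  qed
  have e0: "e \<noteq> 0" by (simp add: e_def)
  have root: "septic e T (\<eta> z) = \<kappa>" if z: "z \<in> \<mu>7" for z
  proof -
    define c where "c = fps_const z"
    have c7: "c ^ 7 = 1" using z by (simp add: c_def fps_const_power)
    have "twist z e = c ^ 2 * e" "twist z T = c * T" "twist z (euler 1) = c ^ 2 * \<eta> z"
      using z twist_graded[OF _ g(4), of z] twist_graded[OF _ gT, of z] twist_\<eta>[OF z]
      by (simp_all add: c_def fps_const_power)
    hence "c ^ 2 * e * septic e T (\<eta> z) = (c * T) ^ 2"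
      using arg_cong[OF \<kappa>, of "twist z"] septic_scale[OF c7]
      by (simp add: \<kappa>_def twist_mult twist_power twist_septic)
    also have "\<dots> = c ^ 2 * e * \<kappa>" by (simp add: power_mult_distrib \<kappa> mult.assoc)
    finally show ?thesis using e0 c7 by auto
  qed
  define P where "P = pCons (- \<kappa>) [:343 * e ^ 6 + 49 * e ^ 2 * T, 343 * e ^ 5 + 35 * e * T,
     147 * e ^ 4 + 7 * T, 49 * e ^ 3, 21 * e ^ 2, 7 * e, 1:]"
  have poly_P: "poly P x = septic e T x - \<kappa>" for x
    unfolding P_def septic_def by (simp add: algebra_simps power_numeral_reduce)
  have "P = (\<Prod>z\<in>\<mu>7. [:- \<eta> z, 1:])"
  proof (rule monic_eq_prod_roots)
    show "inj_on \<eta> \<mu>7"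
    proof (rule inj_onI)
      fix z w assume "z \<in> \<mu>7" "w \<in> \<mu>7" "\<eta> z = \<eta> w"
      moreover from this(3) have "z ^ 5 = w ^ 5"
        by (auto simp: \<eta>_def twist_nth fps_eq_iff dest!: spec[of _ 0])
      ultimately show "z = w" using bij_power_\<mu>7[of 5] by (auto simp: bij_betw_def inj_on_def)
    qed
    show "poly P (\<eta> z) = 0" if "z \<in> \<mu>7" for z
      using root[OF that] by (simp only: poly_P) simp
  qed (simp_all add: P_def card_\<mu>7)
  hence "poly P 0 = (\<Prod>z\<in>\<mu>7. poly [:- \<eta> z, 1:] 0)"
    by (simp only: poly_prod)
  hence "- \<kappa> = (\<Prod>z\<in>\<mu>7. - \<eta> z)" by (simp add: P_def)
  hence "\<kappa> = (\<Prod>z\<in>\<mu>7. \<eta> z)" by (simp add: prod_uminus card_\<mu>7)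
  also have "\<dots> = (\<Prod>z\<in>\<mu>7. fps_const (z ^ 5)) * (\<Prod>z\<in>\<mu>7. twist z (euler 1))"
    by (simp add: \<eta>_def prod.distrib)
  also have "(\<Prod>z\<in>\<mu>7. fps_const (z ^ 5)) = (\<Prod>z\<in>\<mu>7. fps_const z)"
    by (rule prod.reindex_bij_betw[OF bij_power_\<mu>7, of 5 fps_const]) simp
  also have "\<dots> = 1"
    using prod_diff_\<mu>7[of 1 0] by (simp add: prod_uminus card_\<mu>7 del: fps_const_neg)
  finally have \<kappa>_prod: "\<kappa> = (\<Prod>z\<in>\<mu>7. twist z (euler 1))" by simp
  have "T ^ 2 = q\<^sup>2 * ((\<Prod>z\<in>\<mu>7. twist z (euler 1)) * euler 49)"
    unfolding \<kappa>[symmetric] \<kappa>_prod[symmetric] e_def by (simp only: mult_ac)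
  also have "\<dots> = (q * euler 7 ^ 4) ^ 2"
    unfolding norm_euler by (simp add: power_mult_distrib flip: power_mult)
  finally have "T = q * euler 7 ^ 4 \<or> T = - (q * euler 7 ^ 4)"
    by (simp add: power2_eq_iff)
  moreover have "T $ 1 = 1"
  proof -
    have ipoly: "a $ 0 = 1" "b $ 0 = 0" "b $ 1 = -1" "d $ 0 = 0" "d $ 1 = 0" "a $ 1 = 0" "e $ 0 = 0"
      by (simp_all add: a_def b_def d_def e_def res_def euler_def qpoch_def)
    show ?thesis unfolding T_def using ipoly
      by (simp add: power4_eq_xxxx numeral_fps_const)
  qed
  moreover have "(q * euler 7 ^ 4) $ 1 = 1" by (simp add: fps_power_zeroth)
  ultimately have "T = q * euler 7 ^ 4" by (metis fps_neg_nth one_neq_neg_one)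
  thus ?thesis using \<kappa> unfolding \<kappa>_def e_def by simp
qed

section \<open>The operator \<open>U\<^sub>7\<close> on powers of an eta quotient\<close>

definition U7 :: "complex fps \<Rightarrow> complex fps" where
  "U7 g = Abs_fps (\<lambda>n. g $ (7 * n))"

lemma U7_nth: "U7 g $ n = g $ (7 * n)"
  by (simp add: U7_def)

lemma U7_sum: "U7 (sum f A) = (\<Sum>x\<in>A. U7 (f x))"
  by (simp add: fps_eq_iff U7_nth fps_sum_nth)

lemma U7_of_int_mult: "U7 (of_int c * g) = of_int c * U7 g"
  by (simp add: fps_eq_iff U7_nth flip: fps_of_int)

abbreviation dil7 :: "complex fps \<Rightarrow> complex fps" where
  "dil7 g \<equiv> g oo q ^ 7"

lemma dil7_nth: "dil7 g $ n = (if 7 dvd n then g $ (n div 7) else 0)"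
  by (rule dil_nth) simp

lemma U7_dil7_mult: "U7 (dil7 g * h) = g * U7 h"
proof (rule fps_ext)
  fix n
  have "U7 (dil7 g * h) $ n = (\<Sum>i=0..7*n. dil7 g $ i * h $ (7 * n - i))"
    by (simp add: U7_nth fps_mult_nth)
  also have "\<dots> = (\<Sum>i\<in>(\<lambda>j. 7 * j) ` {0..n}. dil7 g $ i * h $ (7 * n - i))"
    by (rule sum.mono_neutral_right) (auto simp: dil7_nth elim!: dvdE)
  also have "\<dots> = (\<Sum>j=0..n. dil7 g $ (7 * j) * h $ (7 * n - 7 * j))"
    by (subst sum.reindex) (auto simp: inj_on_def)
  also have "\<dots> = (\<Sum>j=0..n. g $ j * h $ (7 * (n - j)))"
    by (simp add: dil7_nth diff_mult_distrib2)
  finally show "U7 (dil7 g * h) $ n = (g * U7 h) $ n"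
    by (simp add: fps_mult_nth U7_nth)
qed

lemma inj_dil7: "dil7 g = dil7 h \<Longrightarrow> g = h"
proof (rule fps_ext)
  fix n assume "dil7 g = dil7 h"
  hence "dil7 g $ (7 * n) = dil7 h $ (7 * n)" by simp
  thus "g $ n = h $ n" by (simp add: dil7_nth)
qed

text \<open>Summation over conjugates is seven times the projection to the exponents divisible by \<open>7\<close>. This is the bridge between \<open>U\<^sub>7\<close> and
  power sums of conjugates.\<close>

lemma sum_twist: "(\<Sum>z\<in>\<mu>7. twist z g) = 7 * dil7 (U7 g)"
proof (rule fps_ext)
  fix n
  have "(\<Sum>z\<in>\<mu>7. twist z g) $ n = (\<Sum>z\<in>\<mu>7. z ^ n) * g $ n"
    by (simp add: fps_sum_nth twist_nth sum_distrib_right)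
  also have "\<dots> = (7 * dil7 (U7 g)) $ n"
    unfolding sum_power_\<mu>7 by (auto simp: numeral_fps_const dil7_nth U7_nth)
  finally show "(\<Sum>z\<in>\<mu>7. twist z g) $ n = (7 * dil7 (U7 g)) $ n" .
qed

definition eta_quot :: "complex fps" where "eta_quot = q\<^sup>2 * euler 49 * inverse (euler 1)"
text \<open>A generator of the function field of \<open>X\<^sub>0(7)\<close>; \<open>hauptmodul7\<close> is its image under \<open>q \<mapsto> q\<^sup>7\<close>.\<close>

definition hauptmodul :: "complex fps" where "hauptmodul = q * euler 7 ^ 4 * inverse (euler 1) ^ 4"
definition hauptmodul7 :: "complex fps" where "hauptmodul7 = dil7 hauptmodul"

lemma euler_inverse: "m \<ge> 1 \<Longrightarrow> inverse (euler m) * euler m = 1"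
  by (rule inverse_mult_eq_1) simp

lemma eta_quot_euler: "eta_quot * euler 1 = q\<^sup>2 * euler 49"
  by (simp only: eta_quot_def mult.assoc euler_inverse[OF order_refl] mult_1_right)

lemma hauptmodul_euler: "hauptmodul * euler 1 ^ 4 = q * euler 7 ^ 4"
proof -
  have "inverse (euler 1) ^ 4 * euler 1 ^ 4 = 1"
    using euler_inverse[of 1] by (simp flip: power_mult_distrib)
  thus ?thesis by (simp add: hauptmodul_def mult.assoc)
qed

lemma hauptmodul7_euler: "hauptmodul7 * euler 7 ^ 4 = q ^ 7 * euler 49 ^ 4"
proof -
  have "dil7 (hauptmodul * euler 1 ^ 4) = dil7 (q * euler 7 ^ 4)" by (simp only: hauptmodul_euler)
  thus ?thesis
    using euler_dil[of 7 1] euler_dil[of 7 7]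
    by (simp add: hauptmodul7_def fps_compose_mult_distrib fps_X_fps_compose_startby0 flip: fps_compose_power)
qed

text \<open>This relation carries powers of the Hauptmodul, to which \<open>U\<^sub>7\<close> has to be applied, to powers of the eta quotient
  of level \<open>49\<close>, for which \<open>U\<^sub>7\<close> is known.\<close>

lemma hauptmodul_product: "hauptmodul * hauptmodul7 = eta_quot ^ 4"
proof -
  have "(hauptmodul * hauptmodul7) * (euler 1 ^ 4 * euler 7 ^ 4) = (hauptmodul * euler 1 ^ 4) * (hauptmodul7 * euler 7 ^ 4)" by (simp only: mult_ac)
  also have "\<dots> = (q\<^sup>2 * euler 49) ^ 4 * euler 7 ^ 4"
    unfolding hauptmodul_euler hauptmodul7_euler by (simp add: power_mult_distrib mult_ac flip: power_mult power_Suc)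
  also have "\<dots> = eta_quot ^ 4 * (euler 1 ^ 4 * euler 7 ^ 4)"
    unfolding eta_quot_euler[symmetric] by (simp only: power_mult_distrib mult_ac)
  finally show ?thesis by simp
qed

text \<open>Multiply the equation for \<open>E\<^sub>1\<close> by \<open>w\<^sup>7\<close>, which turns powers of \<open>w E\<^sub>1\<close> into powers of \<open>e\<close>, and divide by \<open>T\<^sup>2\<close>; then
  \<open>e\<^sup>4 / T\<close> is \<open>t(q\<^sup>7)\<close>.\<close>

lemma modular_equation_eta_quot:
  "eta_quot ^ 7 = hauptmodul7\<^sup>2 * (1 + 7 * eta_quot + 21 * eta_quot\<^sup>2 + 49 * eta_quot ^ 3 + 147 * eta_quot ^ 4 + 343 * eta_quot ^ 5 + 343 * eta_quot ^ 6)
         + hauptmodul7 * (7 * eta_quot ^ 4 + 35 * eta_quot ^ 5 + 49 * eta_quot ^ 6)"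
proof -
  define e T F where "e = q\<^sup>2 * euler 49" and "T = q * euler 7 ^ 4" and "F = euler 1"
  have eq: "e * septic e T F = T ^ 2"
    using modular_equation_euler by (simp only: e_def T_def F_def)
  have wF: "eta_quot * F = e" by (simp only: eta_quot_euler e_def F_def)
  have sT: "hauptmodul7 * T = e ^ 4"
  proof -
    have "hauptmodul7 * T = q * (hauptmodul7 * euler 7 ^ 4)" by (simp only: T_def mult_ac)
    also have "\<dots> = q ^ 8 * euler 49 ^ 4" unfolding hauptmodul7_euler by (simp add: eval_nat_numeral mult.assoc)
    also have "\<dots> = e ^ 4" by (simp add: e_def power_mult_distrib flip: power_mult)
    finally show ?thesis .
  qed
  have wFk: "eta_quot ^ 7 * F ^ k = e ^ k * eta_quot ^ (7 - k)" if "k \<le> 7" for k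
  proof -
    have "eta_quot ^ 7 * F ^ k = eta_quot ^ (7 - k) * (eta_quot ^ k * F ^ k)"
      using that by (simp add: mult.assoc[symmetric] flip: power_add)
    also have "eta_quot ^ k * F ^ k = e ^ k" by (simp only: wF power_mult_distrib[symmetric])
    finally show ?thesis by (simp only: mult.commute)
  qed
  have F7: "eta_quot ^ 7 * F ^ 7 = e ^ 7" "eta_quot ^ 7 * F ^ 6 = e ^ 6 * eta_quot" "eta_quot ^ 7 * F ^ 5 = e ^ 5 * eta_quot\<^sup>2"
    "eta_quot ^ 7 * F ^ 4 = e ^ 4 * eta_quot ^ 3" "eta_quot ^ 7 * F ^ 3 = e ^ 3 * eta_quot ^ 4" "eta_quot ^ 7 * F ^ 2 = e ^ 2 * eta_quot ^ 5"
    "eta_quot ^ 7 * F = e * eta_quot ^ 6"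
    using wFk[of 7] wFk[of 6] wFk[of 5] wFk[of 4] wFk[of 3] wFk[of 2] wFk[of 1] by simp_all
  have "T ^ 2 * eta_quot ^ 7 = e * (eta_quot ^ 7 * F ^ 7 + 7 * e * (eta_quot ^ 7 * F ^ 6) + 21 * e ^ 2 * (eta_quot ^ 7 * F ^ 5)
     + 49 * e ^ 3 * (eta_quot ^ 7 * F ^ 4) + (147 * e ^ 4 + 7 * T) * (eta_quot ^ 7 * F ^ 3)
     + (343 * e ^ 5 + 35 * e * T) * (eta_quot ^ 7 * F ^ 2) + (343 * e ^ 6 + 49 * e ^ 2 * T) * (eta_quot ^ 7 * F))"
    unfolding eq[symmetric] septic_def by (simp only: ring_distribs mult_ac)
  also have "\<dots> = (e ^ 4) ^ 2 * (1 + 7 * eta_quot + 21 * eta_quot\<^sup>2 + 49 * eta_quot ^ 3 + 147 * eta_quot ^ 4 + 343 * eta_quot ^ 5 + 343 * eta_quot ^ 6)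
         + e ^ 4 * T * (7 * eta_quot ^ 4 + 35 * eta_quot ^ 5 + 49 * eta_quot ^ 6)"
    unfolding F7 by algebra
  also have "\<dots> = T ^ 2 * (hauptmodul7\<^sup>2 * (1 + 7 * eta_quot + 21 * eta_quot\<^sup>2 + 49 * eta_quot ^ 3 + 147 * eta_quot ^ 4 + 343 * eta_quot ^ 5 + 343 * eta_quot ^ 6)
         + hauptmodul7 * (7 * eta_quot ^ 4 + 35 * eta_quot ^ 5 + 49 * eta_quot ^ 6))"
    unfolding sT[symmetric] by algebra
  finally have cancel: "T ^ 2 * eta_quot ^ 7 = \<dots>" .
  have "T ^ 2 \<noteq> 0" by (simp add: T_def)
  from iffD1[OF mult_left_cancel[OF this] cancel] show ?thesis .
qed

text \<open>Evaluation of integer polynomials at a power series. Integrality of the coefficients is tracked by their type.\<close>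

definition ipoly :: "complex fps \<Rightarrow> int poly \<Rightarrow> complex fps" where
  "ipoly y p = poly (map_poly of_int p) y"

lemma ipoly_0 [simp]: "ipoly y 0 = 0"
  by (simp add: ipoly_def)

lemma ipoly_pCons [simp]: "ipoly y (pCons c p) = of_int c + y * ipoly y p"
  by (simp add: ipoly_def map_poly_pCons)

lemma ipoly_1 [simp]: "ipoly y 1 = 1"
  by (simp add: one_pCons)

lemma ipoly_add: "ipoly y (p + r) = ipoly y p + ipoly y r"
  by (induction p r rule: poly_induct2) (simp_all add: algebra_simps)

lemma ipoly_smult: "ipoly y (smult c p) = of_int c * ipoly y p"
  by (induction p) (simp_all add: algebra_simps)

lemma ipoly_mult: "ipoly y (p * r) = ipoly y p * ipoly y r"
  by (induction p) (simp_all add: ipoly_add ipoly_smult algebra_simps)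

lemma ipoly_sum: "ipoly y (sum f A) = (\<Sum>x\<in>A. ipoly y (f x))"
  by (induction A rule: infinite_finite_induct) (simp_all add: ipoly_add)

lemma ipoly_dil7: "dil7 (ipoly y p) = ipoly (dil7 y) p"
proof (induction p)
  case (pCons c p)
  have "dil7 (of_int c) = of_int c" by (simp flip: fps_of_int)
  thus ?case using pCons by (simp add: fps_compose_add_distrib fps_compose_mult_distrib)
qed simp

lemma ipoly_altdef: "ipoly y p = (\<Sum>i\<le>degree p. of_int (coeff p i) * y ^ i)"
  unfolding ipoly_def poly_altdef
proof (rule sum.mono_neutral_cong_left)
  show "{..degree (map_poly of_int p :: complex fps poly)} \<subseteq> {..degree p}"
    by (auto intro!: degree_le simp: coeff_map_poly coeff_eq_0)
qed (auto simp: coeff_map_poly coeff_eq_0 intro!: le_degree)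

text \<open>Newton's identities as the logarithmic derivative of \<open>\<Prod> (1 - c\<^sub>z X)\<close>. The \<open>c\<^sub>z\<close> will themselves be power series.\<close>

lemma power_sum_generating_function:
  fixes c :: "'i \<Rightarrow> 'a::idom"
  assumes "finite Z"
  defines "R \<equiv> \<Prod>z\<in>Z. 1 - fps_const (c z) * fps_X"
  shows "R * Abs_fps (\<lambda>n. \<Sum>z\<in>Z. c z ^ n) = of_nat (card Z) * R - fps_X * fps_deriv R"
  using assms(1) unfolding R_def
proof (induction Z)
  case (insert a Z)
  define P where "P = (\<Prod>z\<in>Z. 1 - fps_const (c z) * fps_X)"
  define S where "S = Abs_fps (\<lambda>n. \<Sum>z\<in>Z. c z ^ n)"
  define G where "G = Abs_fps (\<lambda>n. c a ^ n)"
  define L where "L = 1 - fps_const (c a) * fps_X"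
  have sum: "Abs_fps (\<lambda>n. \<Sum>z\<in>insert a Z. c z ^ n) = G + S"
    using insert.hyps by (simp add: G_def S_def fps_eq_iff)
  have LG: "L * G = 1"
  proof (rule fps_ext)
    fix n show "(L * G) $ n = 1 $ n"
      by (cases n) (simp_all add: L_def G_def left_diff_distrib mult.assoc)
  qed
  define K where "K = fps_const (c a)"
  have dL: "fps_deriv L = - K" by (simp add: L_def K_def)
  have "L * P * (G + S) = P * (L * G) + L * (P * S)" by (simp only: algebra_simps)
  also have "\<dots> = P + L * (of_nat (card Z) * P - fps_X * fps_deriv P)"
    using insert.IH by (simp only: LG mult_1_right P_def S_def)
  also have "\<dots> = (L * P + fps_X * K * P) + L * (of_nat (card Z) * P - fps_X * fps_deriv P)"
    by (simp add: L_def K_def algebra_simps)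
  also have "\<dots> = of_nat (card Z + 1) * (L * P) - fps_X * fps_deriv (L * P)"
    by (simp add: dL algebra_simps)
  finally have "L * P * (G + S) = of_nat (card Z + 1) * (L * P) - fps_X * fps_deriv (L * P)" .
  moreover have "(\<Prod>z\<in>insert a Z. 1 - fps_const (c z) * fps_X) = L * P"
    unfolding L_def P_def by (rule prod.insert[OF insert.hyps])
  moreover have "card (insert a Z) = card Z + 1" using insert.hyps by simp
  ultimately show ?case by (simp only: sum)
qed (simp add: fps_eq_iff)

lemma coeff_prod_linear:
  fixes c :: "'i \<Rightarrow> 'a::idom"
  assumes "finite Z"
  shows "(\<Prod>z\<in>Z. 1 - fps_const (c z) * fps_X) $ n = coeff (\<Prod>z\<in>Z. [:1, - c z:]) n"
  using assms
proof (induction Z arbitrary: n)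
  case (insert a Z)
  thus ?case by (cases n) (simp_all add: left_diff_distrib mult.assoc coeff_pCons)
qed (simp add: coeff_pCons split: nat.splits)

text \<open>\<open>\<Phi>(X) = X\<^sup>7 - \<Sum> D\<^sub>a X\<^bsup>7-a\<^esup>\<close>, with \<open>D\<^sub>a\<close> the following polynomials in \<open>t(q\<^sup>7)\<close>, is the minimal polynomial of \<open>w\<close> over the
  series in \<open>q\<^sup>7\<close>.\<close>

definition Phi_coeff :: "nat \<Rightarrow> int poly" where
  "Phi_coeff a = (if a = 1 then [:0, 49, 343:] else if a = 2 then [:0, 35, 343:] else if a = 3 then [:0, 7, 147:]
     else if a = 4 then [:0, 0, 49:] else if a = 5 then [:0, 0, 21:] else if a = 6 then [:0, 0, 7:]
     else if a = 7 then [:0, 0, 1:] else 0)"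

text \<open>\<open>a D\<^sub>a / 7\<close>, the inhomogeneous term of Newton's identities for power sums divided by \<open>7\<close>. For \<open>a = 0\<close> the entry is
  the initial value, one seventh of the number of roots.\<close>

definition newton_term :: "nat \<Rightarrow> int poly" where
  "newton_term a = (if a = 0 then 1 else if a = 1 then [:0, 7, 49:] else if a = 2 then [:0, 10, 98:]
     else if a = 3 then [:0, 3, 63:] else if a = 4 then [:0, 0, 28:] else if a = 5 then [:0, 0, 15:]
     else if a = 6 then [:0, 0, 6:] else if a = 7 then [:0, 0, 1:] else 0)"

fun U_poly :: "nat \<Rightarrow> int poly" where
  "U_poly n = newton_term n + (\<Sum>a\<in>{1..<n}. Phi_coeff a * U_poly (n - a))"

declare U_poly.simps [simp del]

lemma U_poly_0: "U_poly 0 = 1"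
  by (subst U_poly.simps) (simp add: newton_term_def)

text \<open>The reversed minimal polynomial. Its roots are distinct since \<open>w\<close> starts with \<open>q\<^sup>2\<close>, whose conjugates differ.\<close>

lemma prod_conjugates:
  "(\<Prod>z\<in>\<mu>7. 1 - fps_const (twist z eta_quot) * fps_X) $ n = (if n = 0 then 1 else - ipoly hauptmodul7 (Phi_coeff n))"
proof -
  define P where "P = [:- (hauptmodul7\<^sup>2), - (7 * hauptmodul7\<^sup>2), - (21 * hauptmodul7\<^sup>2), - (49 * hauptmodul7\<^sup>2), - (147 * hauptmodul7\<^sup>2 + 7 * hauptmodul7),
    - (343 * hauptmodul7\<^sup>2 + 35 * hauptmodul7), - (343 * hauptmodul7\<^sup>2 + 49 * hauptmodul7), 1:]"
  have poly_P: "poly P x = x ^ 7 - (hauptmodul7\<^sup>2 * (1 + 7 * x + 21 * x\<^sup>2 + 49 * x ^ 3 + 147 * x ^ 4 + 343 * x ^ 5 + 343 * x ^ 6)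
         + hauptmodul7 * (7 * x ^ 4 + 35 * x ^ 5 + 49 * x ^ 6))" for x
    unfolding P_def by (simp add: algebra_simps power_numeral_reduce)
  have twist_s: "twist z hauptmodul7 = hauptmodul7" if "z \<in> \<mu>7" for z
    using that by (intro fps_ext) (auto simp: twist_nth hauptmodul7_def dil7_nth power_mult elim!: dvdE)
  have P: "P = (\<Prod>z\<in>\<mu>7. [:- twist z eta_quot, 1:])"
  proof (rule monic_eq_prod_roots)
    have w2: "eta_quot $ 2 = 1"
      by (simp add: eta_quot_def mult.assoc fps_X_power_mult_nth)
    show "inj_on (\<lambda>z. twist z eta_quot) \<mu>7"
    proof (rule inj_onI)
      fix x y assume "x \<in> \<mu>7" "y \<in> \<mu>7" "twist x eta_quot = twist y eta_quot"
      moreover from this(3) have "twist x eta_quot $ 2 = twist y eta_quot $ 2" by simp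
      hence "x ^ 2 = y ^ 2" by (simp add: twist_nth w2)
      ultimately show "x = y" using bij_power_\<mu>7[of 2] by (auto simp: bij_betw_def inj_on_def)
    qed
    show "poly P (twist z eta_quot) = 0" if "z \<in> \<mu>7" for z
      using arg_cong[OF modular_equation_eta_quot, of "twist z"] twist_s[OF that]
      by (simp add: poly_P twist_add twist_mult twist_power)
  qed (simp_all add: P_def card_\<mu>7)
  have "(\<Prod>z\<in>\<mu>7. 1 - fps_const (twist z eta_quot) * fps_X) $ n = coeff (\<Prod>z\<in>\<mu>7. [:1, - twist z eta_quot:]) n"
    by (rule coeff_prod_linear) simp
  also have "(\<Prod>z\<in>\<mu>7. [:1, - twist z eta_quot:]) = reflect_poly P"
    unfolding P reflect_poly_prod
  proof (intro prod.cong refl poly_eqI)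
    fix z n
    show "coeff [:1, - twist z eta_quot:] n = coeff (reflect_poly [:- twist z eta_quot, 1:]) n"
      by (cases n) (simp_all add: coeff_reflect_poly coeff_pCons split: nat.split)
  qed
  also have "coeff (reflect_poly P) n = (if n = 0 then 1 else - ipoly hauptmodul7 (Phi_coeff n))"
  proof -
    have deg: "degree P = 7" by (simp add: P_def)
    consider "n \<in> {0,1,2,3,4,5,6,7}" | "n > 7" by fastforce
    thus ?thesis
    proof cases
      case 1
      thus ?thesis unfolding coeff_reflect_poly deg
        by (auto simp: P_def Phi_coeff_def coeff_pCons numeral_eq_Suc power2_eq_square algebra_simps)
    qed (simp add: coeff_reflect_poly deg Phi_coeff_def)
  qed
  finally show ?thesis .
qed

text \<open>One seventh of the power sums of the conjugates, viewed as a series in \<open>q\<^sup>7\<close>, satisfies the recursion that defines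
  \<open>U_poly\<close>.\<close>

lemma U7_eta_quot_power: "U7 (eta_quot ^ n) = ipoly hauptmodul (U_poly n)"
proof -
  define p where "p = (\<lambda>n. \<Sum>z\<in>\<mu>7. twist z eta_quot ^ n)"
  define R where "R = (\<Prod>z\<in>\<mu>7. 1 - fps_const (twist z eta_quot) * fps_X)"
  have R: "R $ n = (if n = 0 then 1 else - ipoly hauptmodul7 (Phi_coeff n))" for n
    unfolding R_def by (rule prod_conjugates)
  have p_U: "p n = 7 * dil7 (U7 (eta_quot ^ n))" for n
    unfolding p_def twist_power[symmetric] sum_twist ..
  have newton: "p n = (\<Sum>a\<in>{1..<n}. ipoly hauptmodul7 (Phi_coeff a) * p (n - a)) + of_nat n * ipoly hauptmodul7 (Phi_coeff n)" if n: "n \<ge> 1" for n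
  proof -
    have "R * Abs_fps p = of_nat 7 * R - fps_X * fps_deriv R"
      using power_sum_generating_function[of \<mu>7 "\<lambda>z. twist z eta_quot"] by (simp add: R_def p_def card_\<mu>7)
    hence "(R * Abs_fps p) $ n = (of_nat 7 * R - fps_X * fps_deriv R) $ n" by simp
    also have "\<dots> = (7 - of_nat n) * R $ n"
      using n by (cases n) (simp_all add: numeral_fps_const algebra_simps)
    also have "(R * Abs_fps p) $ n = p n - (\<Sum>a\<in>{1..n}. ipoly hauptmodul7 (Phi_coeff a) * p (n - a))"
    proof -
      have "(R * Abs_fps p) $ n = (\<Sum>i\<in>insert 0 {1..n}. R $ i * p (n - i))"
        unfolding fps_mult_nth by (intro sum.cong) auto
      also have "\<dots> = p n + (\<Sum>i\<in>{1..n}. R $ i * p (n - i))"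
        by (subst sum.insert) (auto simp: R)
      also have "(\<Sum>i\<in>{1..n}. R $ i * p (n - i)) = (\<Sum>i\<in>{1..n}. - (ipoly hauptmodul7 (Phi_coeff i) * p (n - i)))"
        by (intro sum.cong) (auto simp: R)
      finally show ?thesis by (simp add: sum_negf)
    qed
    also have "{1..n} = insert n {1..<n}" using n by auto
    also have "(\<Sum>a\<in>insert n {1..<n}. ipoly hauptmodul7 (Phi_coeff a) * p (n - a))
        = ipoly hauptmodul7 (Phi_coeff n) * 7 + (\<Sum>a\<in>{1..<n}. ipoly hauptmodul7 (Phi_coeff a) * p (n - a))"
      by (subst sum.insert) (auto simp: p_def card_\<mu>7)
    finally show ?thesis using n by (simp add: R algebra_simps)
  qed
  have init: "of_nat n * ipoly hauptmodul7 (Phi_coeff n) = 7 * ipoly hauptmodul7 (newton_term n)" if "n \<ge> 1" for n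
  proof -
    have "n = 1 \<or> n = 2 \<or> n = 3 \<or> n = 4 \<or> n = 5 \<or> n = 6 \<or> n = 7 \<or> n > 7"
      using that by linarith
    thus ?thesis by (elim disjE) (simp_all add: Phi_coeff_def newton_term_def algebra_simps)
  qed
  have "p n = 7 * ipoly hauptmodul7 (U_poly n)"
  proof (induction n rule: less_induct)
    case (less n)
    show ?case
    proof (cases "n = 0")
      case True
      thus ?thesis by (simp add: p_def card_\<mu>7 U_poly_0)
    next
      case False
      hence n: "n \<ge> 1" by simp
      have "p n = (\<Sum>a\<in>{1..<n}. ipoly hauptmodul7 (Phi_coeff a) * p (n - a)) + 7 * ipoly hauptmodul7 (newton_term n)"
        using newton[OF n] unfolding init[OF n] .
      also have "(\<Sum>a\<in>{1..<n}. ipoly hauptmodul7 (Phi_coeff a) * p (n - a)) = (\<Sum>a\<in>{1..<n}. 7 * ipoly hauptmodul7 (Phi_coeff a * U_poly (n - a)))"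
        using n by (intro sum.cong refl) (simp add: less.IH ipoly_mult)
      also have "\<dots> = 7 * ipoly hauptmodul7 (\<Sum>a\<in>{1..<n}. Phi_coeff a * U_poly (n - a))"
        by (simp only: ipoly_sum sum_distrib_left)
      also have "\<dots> + 7 * ipoly hauptmodul7 (newton_term n) = 7 * ipoly hauptmodul7 (U_poly n)"
        unfolding U_poly.simps[of n] ipoly_add by (simp only: distrib_left add.commute)
      finally show ?thesis .
    qed
  qed
  hence "dil7 (U7 (eta_quot ^ n)) = dil7 (ipoly hauptmodul (U_poly n))"
    unfolding p_U ipoly_dil7 hauptmodul7_def[symmetric] by simp
  thus ?thesis by (rule inj_dil7)
qed

text \<open>Divisibility by a power of \<open>7\<close> with integer exponent, where negative exponents impose no condition. The bounds below then need no case
  distinctions.\<close>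

definition pow7_dvd :: "int \<Rightarrow> int \<Rightarrow> bool" where
  "pow7_dvd e x \<longleftrightarrow> 7 ^ nat e dvd x"

lemma pow7_dvd_0 [simp]: "pow7_dvd e 0"
  by (simp add: pow7_dvd_def)

lemma pow7_dvd_mono: "pow7_dvd e x \<Longrightarrow> f \<le> e \<Longrightarrow> pow7_dvd f x"
  unfolding pow7_dvd_def by (erule dvd_trans[rotated]) (auto intro!: le_imp_power_dvd nat_mono)

lemma pow7_dvd_mult: "pow7_dvd e x \<Longrightarrow> pow7_dvd f y \<Longrightarrow> pow7_dvd (e + f) (x * y)"
proof -
  assume "pow7_dvd e x" "pow7_dvd f y"
  hence "7 ^ (nat e + nat f) dvd x * y" by (simp add: pow7_dvd_def power_add mult_dvd_mono)
  moreover have "nat (e + f) \<le> nat e + nat f" by simp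
  ultimately show ?thesis unfolding pow7_dvd_def by (meson dvd_trans le_imp_power_dvd)
qed

lemma pow7_dvd_add: "pow7_dvd e x \<Longrightarrow> pow7_dvd e y \<Longrightarrow> pow7_dvd e (x + y)"
  by (simp add: pow7_dvd_def)

lemma pow7_dvd_sum: "(\<And>i. i \<in> A \<Longrightarrow> pow7_dvd e (f i)) \<Longrightarrow> pow7_dvd e (sum f A)"
  by (simp add: pow7_dvd_def dvd_sum)

text \<open>The coefficient of \<open>t\<^sup>i\<close> in \<open>D\<^sub>a\<close> is divisible by \<open>7\<close> at least \<open>(7 i - 2 a) / 4\<close> times, rounded up. Rounding up here and
  down in the bound for \<open>U_poly\<close> is what makes the bounds multiply.\<close>

lemma coeff_Phi:
  shows "pow7_dvd ((7 * int i - 2 * int a + 3) div 4) (coeff (Phi_coeff a) i)"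
    and "7 * i < 2 * a \<Longrightarrow> coeff (Phi_coeff a) i = 0"
proof -
  consider "i = 0" | "i = 1" | "i = 2" | j where "i = Suc (Suc (Suc j))"
    by (metis One_nat_def Suc_1 not0_implies_Suc)
  hence "pow7_dvd ((7 * int i - 2 * int a + 3) div 4) (coeff (Phi_coeff a) i) \<and> (7 * i < 2 * a \<longrightarrow> coeff (Phi_coeff a) i = 0)"
    by cases (auto simp: Phi_coeff_def pow7_dvd_def numeral_2_eq_2)
  thus "pow7_dvd ((7 * int i - 2 * int a + 3) div 4) (coeff (Phi_coeff a) i)"
    "7 * i < 2 * a \<Longrightarrow> coeff (Phi_coeff a) i = 0" by blast+
qed

lemma coeff_newton_term:
  shows "pow7_dvd ((7 * int i - 2 * int a - 1) div 4) (coeff (newton_term a) i)"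
    and "7 * i < 2 * a \<Longrightarrow> coeff (newton_term a) i = 0"
proof -
  consider "i = 0" | "i = 1" | "i = 2" | j where "i = Suc (Suc (Suc j))"
    by (metis One_nat_def Suc_1 not0_implies_Suc)
  hence "pow7_dvd ((7 * int i - 2 * int a - 1) div 4) (coeff (newton_term a) i) \<and> (7 * i < 2 * a \<longrightarrow> coeff (newton_term a) i = 0)"
    by cases (auto simp: newton_term_def pow7_dvd_def numeral_2_eq_2 one_pCons coeff_pCons)
  thus "pow7_dvd ((7 * int i - 2 * int a - 1) div 4) (coeff (newton_term a) i)"
    "7 * i < 2 * a \<Longrightarrow> coeff (newton_term a) i = 0" by blast+
qed

lemma div4_add: "(x + y) div 4 \<le> (x + 3) div 4 + y div (4 :: int)"
  by presburger

text \<open>The weight \<open>7 j - 2 n\<close> is additive in the recursion. The vanishing of low coefficients reflects that \<open>w\<^sup>n\<close> starts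
  with \<open>q\<^sup>2\<^sup>n\<close>; it allows division by powers of the Hauptmodul.\<close>

theorem coeff_U_poly:
  "pow7_dvd ((7 * int j - 2 * int n - 1) div 4) (coeff (U_poly n) j) \<and> (7 * j < 2 * n \<longrightarrow> coeff (U_poly n) j = 0)"
proof (induction n arbitrary: j rule: less_induct)
  case (less n)
  have rec: "coeff (U_poly n) j = coeff (newton_term n) j
      + (\<Sum>a\<in>{1..<n}. \<Sum>i\<le>j. coeff (Phi_coeff a) i * coeff (U_poly (n - a)) (j - i))"
    by (simp add: U_poly.simps[of n] coeff_sum coeff_mult)
  have A: "pow7_dvd ((7 * int j - 2 * int n - 1) div 4) (coeff (Phi_coeff a) i * coeff (U_poly (n - a)) (j - i))"
    if "a \<in> {1..<n}" "i \<le> j" for a i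
  proof -
    have factors: "pow7_dvd ((7 * int i - 2 * int a + 3) div 4 + (7 * int (j - i) - 2 * int (n - a) - 1) div 4)
        (coeff (Phi_coeff a) i * coeff (U_poly (n - a)) (j - i))"
      using that less[of "n - a" "j - i"] by (intro pow7_dvd_mult coeff_Phi) auto
    have eq: "7 * int j - 2 * int n - 1
        = (7 * int i - 2 * int a) + (7 * int (j - i) - 2 * int (n - a) - 1)"
      using that by (simp add: of_nat_diff)
    show ?thesis unfolding eq by (rule pow7_dvd_mono[OF factors div4_add])
  qed
  have B: "coeff (Phi_coeff a) i * coeff (U_poly (n - a)) (j - i) = 0"
    if "a \<in> {1..<n}" "i \<le> j" "7 * j < 2 * n" for a i
  proof -
    have "7 * i < 2 * a \<or> 7 * (j - i) < 2 * (n - a)" using that by auto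
    thus ?thesis using coeff_Phi(2)[of i a] less[of "n - a" "j - i"] that by auto
  qed
  show ?case
  proof (intro conjI impI)
    show "pow7_dvd ((7 * int j - 2 * int n - 1) div 4) (coeff (U_poly n) j)"
      unfolding rec by (intro pow7_dvd_add pow7_dvd_sum coeff_newton_term A) auto
    assume j: "7 * j < 2 * n"
    have "(\<Sum>a\<in>{1..<n}. \<Sum>i\<le>j. coeff (Phi_coeff a) i * coeff (U_poly (n - a)) (j - i)) = 0"
      by (intro sum.neutral ballI) (use B j in auto)
    thus "coeff (U_poly n) j = 0" unfolding rec coeff_newton_term(2)[OF j] by simp
  qed
qed

section \<open>Generating functions of regular partitions\<close>

definition parts_in :: "nat set \<Rightarrow> nat \<Rightarrow> nat multiset set" where
  "parts_in S n = {P. set_mset P \<subseteq> S \<and> sum_mset P = n}"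

text \<open>As \<open>0\<close> divides only \<open>0\<close>, the \<open>0\<close>-regular partitions are all partitions.\<close>

lemma finite_parts_in:
  assumes "0 \<notin> S"
  shows "finite (parts_in S n)"
  by (rule finite_subset[OF _ finite_regular_partitions[of 0 n]])
     (use assms in \<open>auto simp: parts_in_def regular_partitions_def intro!: Nat.gr0I\<close>)

text \<open>Remove one copy of \<open>m\<close> if there is one.\<close>

lemma parts_in_insert:
  assumes "m \<notin> S"
  shows "parts_in (insert m S) n = parts_in S n \<union> (if m \<le> n then add_mset m ` parts_in (insert m S) (n - m) else {})"
    (is "?A = ?B \<union> ?C")
proof (intro equalityI subsetI)
  fix P assume P: "P \<in> ?A"
  show "P \<in> ?B \<union> ?C"
  proof (cases "m \<in># P")
    case True
    then obtain R where R: "P = add_mset m R" by (metis mset_add)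
    hence "m \<le> n" "R \<in> parts_in (insert m S) (n - m)" using P by (auto simp: parts_in_def)
    thus ?thesis using R by auto
  next
    case False
    thus ?thesis using P by (auto simp: parts_in_def)
  qed
next
  fix P assume "P \<in> ?B \<union> ?C"
  thus "P \<in> ?A" by (auto simp: parts_in_def split: if_splits)
qed

lemma parts_in_generating_function:
  assumes "finite S" "0 \<notin> S"
  shows "Abs_fps (\<lambda>n. of_nat (card (parts_in S n))) * (\<Prod>m\<in>S. 1 - q ^ m) = 1"
  using assms
proof (induction S)
  case empty
  have "parts_in {} n = (if n = 0 then {{#}} else {})" for n
    by (auto simp: parts_in_def)
  thus ?case by (simp add: fps_eq_iff)
next
  case (insert m S)
  define F G where "F = (Abs_fps (\<lambda>n. of_nat (card (parts_in S n))) :: complex fps)"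
    and "G = (Abs_fps (\<lambda>n. of_nat (card (parts_in (insert m S) n))) :: complex fps)"
  have "G $ n = (F + q ^ m * G) $ n" for n
  proof -
    have "card (parts_in (insert m S) n) = card (parts_in S n)
        + card (if m \<le> n then add_mset m ` parts_in (insert m S) (n - m) else {})"
    proof (subst parts_in_insert[OF insert.hyps(2)], rule card_Un_disjoint)
      show "finite (parts_in S n)" 
        using insert.prems by (intro finite_parts_in) auto
      have "finite (parts_in (insert m S) (n - m))"
        using insert.prems by (rule finite_parts_in)
      thus "finite (if m \<le> n then add_mset m ` parts_in (insert m S) (n - m) else {})"
        by simp
      show "parts_in S n \<inter> (if m \<le> n then add_mset m ` parts_in (insert m S) (n - m) else {}) = {}"
      proof -
        have "m \<notin># P" if "P \<in> parts_in S n" for P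
          using that insert.hyps(2) by (auto simp: parts_in_def)
        thus ?thesis by (cases "m \<le> n") fastforce+
      qed
    qed
    also have "card (if m \<le> n then add_mset m ` parts_in (insert m S) (n - m) else {})
        = (if m \<le> n then card (parts_in (insert m S) (n - m)) else 0)"
      by (simp add: card_image inj_on_def)
    finally show ?thesis by (simp add: F_def G_def fps_X_power_mult_nth)
  qed
  hence "G = F + q ^ m * G" by (simp add: fps_eq_iff)
  hence "G * (1 - q ^ m) = F" by (simp add: algebra_simps)
  hence "G * (1 - q ^ m) * (\<Prod>m\<in>S. 1 - q ^ m) = 1"
    using insert by (simp add: F_def)
  thus ?case using insert.hyps by (simp add: G_def mult.assoc)
qed

lemma regular_partitions_eq_parts_in:
  assumes "n \<le> N"
  shows "regular_partitions l n = parts_in {m\<in>{1..N}. \<not> l dvd m} n"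
proof -
  have "p \<le> n" if "p \<in># P" "sum_mset P = n" for p and P :: "nat multiset"
    using that(2) sum_mset.remove[OF that(1)] by auto
  thus ?thesis using assms
    by (fastforce simp: regular_partitions_def parts_in_def intro: order_trans)
qed

text \<open>The Euler product is cut off at \<open>l n\<close> instead of \<open>n\<close>: exactly \<open>n\<close> multiples of \<open>l\<close> remain then, one for each factor
  of the truncated numerator.\<close>

theorem b_reg_generating_function:
  assumes "l \<ge> 1"
  shows "Abs_fps (\<lambda>n. of_nat (b_reg l n)) * euler 1 = euler l"
proof (rule eq_uptoI_all)
  fix n
  define N where "N = l * n"
  define S where "S = {m\<in>{1..N}. \<not> l dvd m}"
  define G where "G = (Abs_fps (\<lambda>n. of_nat (card (parts_in S n))) :: complex fps)"
  have nN: "n \<le> N" using mult_le_mono1[OF assms, of n] by (simp add: N_def)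
  have 1: "eq_upto n (Abs_fps (\<lambda>n. of_nat (b_reg l n))) G"
    using nN by (auto simp: eq_upto_def G_def S_def b_reg_def regular_partitions_eq_parts_in[of _ N])
  have split: "qpoch 1 N = (\<Prod>m\<in>S. 1 - q ^ m) * qpoch l n"
  proof -
    have "{1..N} = S \<union> (\<lambda>i. l * i) ` {1..n}" 
      using assms by (auto simp: S_def N_def elim!: dvdE)
    moreover have "S \<inter> (\<lambda>i. l * i) ` {1..n} = {}" by (auto simp: S_def)
    ultimately have "(\<Prod>m\<in>{1..N}. 1 - q ^ m) = (\<Prod>m\<in>S. 1 - q ^ m) * (\<Prod>m\<in>(\<lambda>i. l * i) ` {1..n}. 1 - q ^ m)"
      by (metis (no_types, lifting) finite_Un finite_atLeastAtMost prod.union_disjoint)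
    also have "(\<Prod>m\<in>(\<lambda>i. l * i) ` {1..n}. 1 - q ^ m) = qpoch l n"
      unfolding qpoch_def using assms by (subst prod.reindex) (auto simp: inj_on_def)
    finally show ?thesis by (simp add: qpoch_def)
  qed
  have "G * qpoch 1 N = G * (\<Prod>m\<in>S. 1 - q ^ m) * qpoch l n"
    unfolding split by (simp only: mult.assoc)
  also have "G * (\<Prod>m\<in>S. 1 - q ^ m) = 1"
    unfolding G_def by (rule parts_in_generating_function) (auto simp: S_def)
  finally have eq: "G * qpoch 1 N = qpoch l n" by simp
  have "eq_upto n (Abs_fps (\<lambda>n. of_nat (b_reg l n)) * euler 1) (G * qpoch 1 N)"
    using nN by (intro eq_upto_mult 1 eq_upto_euler) auto
  moreover have "eq_upto n (qpoch l n) (euler l)"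
    using assms by (intro eq_upto_sym[OF eq_upto_euler]) auto
  ultimately show "eq_upto n (Abs_fps (\<lambda>n. of_nat (b_reg l n)) * euler 1) (euler l)"
    unfolding eq by (rule eq_upto_trans)
qed

definition progression :: "nat \<Rightarrow> nat \<Rightarrow> complex fps \<Rightarrow> complex fps" where
  "progression m r g = Abs_fps (\<lambda>n. g $ (m * n + r))"

lemma progression_nth: "progression m r g $ n = g $ (m * n + r)"
  by (simp add: progression_def)

lemma progression_progression: "progression a r (progression m l g) = progression (m * a) (m * r + l) g"
  by (simp add: fps_eq_iff progression_nth algebra_simps)

text \<open>Series in \<open>q\<^sup>m\<close> are scalars for selecting a residue class modulo \<open>m\<close>.\<close>

lemma progression_dil_mult:
  assumes "r < m"
  shows "progression m r ((g oo q ^ m) * h) = g * progression m r h"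
proof (rule fps_ext)
  fix n
  have m: "m \<ge> 1" using assms by simp
  have le: "m * j \<le> m * n + r \<longleftrightarrow> j \<le> n" for j
  proof
    assume "m * j \<le> m * n + r"
    hence "m * j < m * Suc n" using assms by simp
    thus "j \<le> n" unfolding mult_less_cancel1 less_Suc_eq_le by blast
  qed (simp add: trans_le_add1)
  have "progression m r ((g oo q ^ m) * h) $ n = (\<Sum>i=0..m*n+r. (g oo q ^ m) $ i * h $ (m * n + r - i))"
    by (simp add: progression_nth fps_mult_nth)
  also have "\<dots> = (\<Sum>i\<in>(\<lambda>j. m * j) ` {0..n}. (g oo q ^ m) $ i * h $ (m * n + r - i))"
    by (rule sum.mono_neutral_right) (auto simp: dil_nth[OF m] le elim!: dvdE)
  also have "\<dots> = (\<Sum>j=0..n. (g oo q ^ m) $ (m * j) * h $ (m * n + r - m * j))"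
    using m by (subst sum.reindex) (auto simp: inj_on_def)
  also have "\<dots> = (\<Sum>j=0..n. g $ j * h $ (m * (n - j) + r))"
    using m by (intro sum.cong refl) (auto simp: dil_nth[OF m] diff_mult_distrib2)
  finally show "progression m r ((g oo q ^ m) * h) $ n = (g * progression m r h) $ n"
    by (simp add: fps_mult_nth progression_nth)
qed

section \<open>Polynomials in the Hauptmodul under the selection of residues\<close>

lemma U7_shift:
  assumes "1 \<le> a" "a \<le> 7"
  shows "U7 (q ^ a * g) = q * progression 7 (7 - a) g"
proof (rule fps_ext)
  fix n
  show "U7 (q ^ a * g) $ n = (q * progression 7 (7 - a) g) $ n"
    using assms by (cases n) (auto simp: U7_nth progression_nth fps_X_power_mult_nth add.commute)
qed

lemma ipoly_monom: "ipoly y (monom 1 i) = y ^ i"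
  by (induction i) (simp_all add: monom_Suc monom_0)

lemma ipoly_poly_shift:
  assumes "\<And>j. j < i \<Longrightarrow> coeff p j = 0"
  shows "ipoly y p = y ^ i * ipoly y (poly_shift i p)"
proof -
  have "p = monom 1 i * poly_shift i p"
    by (rule poly_eqI) (use assms in \<open>auto simp: coeff_monom_mult coeff_poly_shift\<close>)
  thus ?thesis by (metis ipoly_mult ipoly_monom)
qed

text \<open>If \<open>U\<^sub>7(g t\<^sup>i) = k t\<^sup>-\<^sup>i U\<^sub>7(w\<^bsup>f i\<^esup>)\<close> for all relevant \<open>i\<close>, then \<open>U\<^sub>7\<close> maps \<open>g x(t)\<close> to \<open>k\<close> times this polynomial in \<open>t\<close>.
  Division by \<open>t\<^sup>i\<close> is a shift of coefficients.\<close>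

definition U7_image :: "int poly \<Rightarrow> (nat \<Rightarrow> nat) \<Rightarrow> int poly" where
  "U7_image x f = (\<Sum>i\<le>degree x. smult (coeff x i) (poly_shift i (U_poly (f i))))"

lemma coeff_U7_image: "coeff (U7_image x f) j = (\<Sum>i\<le>degree x. coeff x i * coeff (U_poly (f i)) (j + i))"
  by (simp add: U7_image_def coeff_sum coeff_poly_shift)

lemma U7_ipoly:
  assumes "\<And>i. coeff x i \<noteq> 0 \<Longrightarrow> U7 (g * hauptmodul ^ i) = k * ipoly hauptmodul (poly_shift i (U_poly (f i)))"
  shows "U7 (g * ipoly hauptmodul x) = k * ipoly hauptmodul (U7_image x f)"
proof -
  have "g * ipoly hauptmodul x = (\<Sum>i\<le>degree x. of_int (coeff x i) * (g * hauptmodul ^ i))"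
    by (simp add: ipoly_altdef sum_distrib_left mult_ac)
  hence "U7 (g * ipoly hauptmodul x) = (\<Sum>i\<le>degree x. of_int (coeff x i) * U7 (g * hauptmodul ^ i))"
    by (simp only: U7_sum U7_of_int_mult)
  also have "\<dots> = (\<Sum>i\<le>degree x. of_int (coeff x i) * (k * ipoly hauptmodul (poly_shift i (U_poly (f i)))))"
    by (intro sum.cong refl) (metis assms mult_zero_left of_int_0)
  also have "\<dots> = k * ipoly hauptmodul (U7_image x f)"
    by (simp add: U7_image_def ipoly_sum ipoly_smult sum_distrib_left mult_ac)
  finally show ?thesis .
qed

text \<open>For odd exponents of \<open>7\<close> the series are polynomials in the Hauptmodul times \<open>E\<^sub>1 / E\<^sub>7\<close> or \<open>E\<^sub>7 / E\<^sub>1\<close>, alternately.\<close>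

definition eta_ratio :: "complex fps" where "eta_ratio = euler 7 * inverse (euler 1)"
definition eta_ratio_inv :: "complex fps" where "eta_ratio_inv = euler 1 * inverse (euler 7)"

lemma hauptmodul_nonzero: "hauptmodul \<noteq> 0"
  by (simp add: hauptmodul_def)

text \<open>The vanishing of the low coefficients turns the factor \<open>t\<^sup>i\<close> on the left into a shift on the right.\<close>

lemma U7_cancel_hauptmodul:
  assumes "hauptmodul ^ i * U7 g = ipoly hauptmodul (U_poly n) * k" "\<And>j. j < i \<Longrightarrow> coeff (U_poly n) j = 0"
  shows "U7 g = k * ipoly hauptmodul (poly_shift i (U_poly n))"
proof -
  have "hauptmodul ^ i * U7 g = hauptmodul ^ i * (k * ipoly hauptmodul (poly_shift i (U_poly n)))"
    using assms(1) ipoly_poly_shift[OF assms(2), where y = hauptmodul] by (simp only: mult_ac)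
  moreover have "hauptmodul ^ i \<noteq> 0" using hauptmodul_nonzero by simp
  ultimately show ?thesis using mult_left_cancel by blast
qed

text \<open>Move \<open>t\<^sup>i\<close> into \<open>U\<^sub>7\<close> as a series in \<open>q\<^sup>7\<close> and use \<open>t(q) t(q\<^sup>7) = w\<^sup>4\<close>.\<close>

lemma hauptmodul_power_U7: "hauptmodul ^ i * U7 (g * hauptmodul ^ i) = U7 (g * eta_quot ^ (4 * i))"
proof -
  have "hauptmodul ^ i * U7 (g * hauptmodul ^ i) = U7 (dil7 (hauptmodul ^ i) * (g * hauptmodul ^ i))" by (simp only: U7_dil7_mult)
  also have "dil7 (hauptmodul ^ i) = hauptmodul7 ^ i" by (simp add: hauptmodul7_def fps_compose_power)
  also have "hauptmodul7 ^ i * (g * hauptmodul ^ i) = g * (hauptmodul * hauptmodul7) ^ i" by (simp only: power_mult_distrib mult_ac)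
  also have "\<dots> = g * eta_quot ^ (4 * i)" by (simp only: hauptmodul_product power_mult)
  finally show ?thesis .
qed

lemma U7_hauptmodul_power:
  assumes "i \<ge> 1"
  shows "U7 (1 * hauptmodul ^ i) = 1 * ipoly hauptmodul (poly_shift i (U_poly (4 * i)))"
proof (rule U7_cancel_hauptmodul)
  show "hauptmodul ^ i * U7 (1 * hauptmodul ^ i) = ipoly hauptmodul (U_poly (4 * i)) * 1"
    unfolding hauptmodul_power_U7 by (simp only: mult_1_left mult_1_right U7_eta_quot_power)
qed (use coeff_U_poly in auto)

lemma U7_eta_quot_hauptmodul_power: "U7 (eta_quot * hauptmodul ^ i) = 1 * ipoly hauptmodul (poly_shift i (U_poly (4 * i + 1)))"
proof (rule U7_cancel_hauptmodul)
  show "hauptmodul ^ i * U7 (eta_quot * hauptmodul ^ i) = ipoly hauptmodul (U_poly (4 * i + 1)) * 1"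
    unfolding hauptmodul_power_U7 by (simp add: U7_eta_quot_power flip: power_Suc)
qed (use coeff_U_poly in auto)

lemma eta_ratio_euler: "eta_ratio * euler 1 = euler 7"
  using euler_inverse[OF order_refl] by (simp only: eta_ratio_def mult.assoc mult_1_right)

lemma eta_ratio_inv_euler: "eta_ratio_inv * euler 7 = euler 1"
  using euler_inverse[of 7] by (simp add: eta_ratio_inv_def mult.assoc)

lemma dil7_eta_ratio: "dil7 eta_ratio * euler 7 = euler 49"
proof -
  have "dil7 (eta_ratio * euler 1) = dil7 (euler 7)" by (simp only: eta_ratio_euler)
  thus ?thesis using euler_dil[of 7 1] euler_dil[of 7 7] by (simp add: fps_compose_mult_distrib)
qed

lemma dil7_eta_ratio_inv: "dil7 eta_ratio_inv * euler 49 = euler 7"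
proof -
  have "dil7 (eta_ratio_inv * euler 7) = dil7 (euler 1)" by (simp only: eta_ratio_inv_euler)
  thus ?thesis using euler_dil[of 7 1] euler_dil[of 7 7] by (simp add: fps_compose_mult_distrib)
qed

lemma eta_ratio_inv_eta_quot: "q ^ 5 * eta_ratio_inv * eta_quot = dil7 (q * eta_ratio)"
proof -
  have "q ^ 5 * eta_ratio_inv * eta_quot * (euler 7 * euler 1) = q ^ 5 * (eta_ratio_inv * euler 7) * (eta_quot * euler 1)" by (simp only: mult_ac)
  also have "\<dots> = q ^ 7 * (dil7 eta_ratio * euler 7) * euler 1"
  proof -
    have "q ^ 7 = q ^ 5 * q\<^sup>2" by (simp flip: power_add)
    thus ?thesis unfolding eta_ratio_inv_euler eta_quot_euler dil7_eta_ratio by (simp only: mult_ac)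
  qed
  also have "\<dots> = dil7 (q * eta_ratio) * (euler 7 * euler 1)"
    by (simp add: fps_compose_mult_distrib fps_X_fps_compose_startby0 mult_ac)
  finally show ?thesis by simp
qed

lemma q2_eta_ratio: "q\<^sup>2 * eta_ratio = dil7 eta_ratio_inv * eta_quot"
proof -
  have "q\<^sup>2 * eta_ratio * (euler 49 * euler 1) = q\<^sup>2 * euler 49 * (eta_ratio * euler 1)" by (simp only: mult_ac)
  also have "\<dots> = (dil7 eta_ratio_inv * euler 49) * (eta_quot * euler 1)" unfolding eta_ratio_euler eta_quot_euler dil7_eta_ratio_inv by (simp only: mult_ac)
  also have "\<dots> = dil7 eta_ratio_inv * eta_quot * (euler 49 * euler 1)" by (simp only: mult_ac)
  finally show ?thesis by simp
qed

lemma U7_eta_ratio_inv_hauptmodul_power: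
  assumes "i \<ge> 1"
  shows "U7 (q ^ 5 * eta_ratio_inv * hauptmodul ^ i) = q * eta_ratio * ipoly hauptmodul (poly_shift i (U_poly (4 * i - 1)))"
proof (rule U7_cancel_hauptmodul)
  have "eta_quot ^ (4 * i) = eta_quot * eta_quot ^ (4 * i - 1)" using assms by (simp flip: power_Suc)
  hence "hauptmodul ^ i * U7 (q ^ 5 * eta_ratio_inv * hauptmodul ^ i) = U7 (dil7 (q * eta_ratio) * eta_quot ^ (4 * i - 1))"
    unfolding hauptmodul_power_U7 eta_ratio_inv_eta_quot[symmetric] by (simp only: mult_ac)
  thus "hauptmodul ^ i * U7 (q ^ 5 * eta_ratio_inv * hauptmodul ^ i) = ipoly hauptmodul (U_poly (4 * i - 1)) * (q * eta_ratio)"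
    by (simp only: U7_dil7_mult U7_eta_quot_power mult_ac)
qed (use coeff_U_poly assms in auto)

lemma U7_eta_ratio_hauptmodul_power: "U7 (q\<^sup>2 * eta_ratio * hauptmodul ^ i) = eta_ratio_inv * ipoly hauptmodul (poly_shift i (U_poly (4 * i + 1)))"
  unfolding q2_eta_ratio mult.assoc U7_dil7_mult U7_eta_quot_hauptmodul_power by simp

text \<open>The class of polynomials that the selections preserve: no constant term, all coefficients divisible by \<open>7\<^sup>c\<close>, and a
  slope of \<open>7/4\<close> in the exponents, so that higher coefficients make up for weaker bounds on their images.\<close>

definition val_ge :: "int \<Rightarrow> int poly \<Rightarrow> bool" where
  "val_ge c x \<longleftrightarrow> coeff x 0 = 0 \<and> (\<forall>j. pow7_dvd (c + (7 * int j - 7) div 4) (coeff x j))"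

text \<open>The class met halfway through a double selection, where a constant term occurs.\<close>

definition val_ge_mid :: "int \<Rightarrow> int poly \<Rightarrow> bool" where
  "val_ge_mid c x \<longleftrightarrow> (\<forall>j. pow7_dvd (c + 7 * int j div 4) (coeff x j))"

text \<open>Rounding costs at most \<open>6/4\<close> on the right, and the resulting inequality between integers only has to hold with
  an error of less than \<open>1\<close>.\<close>

lemma quarter_le:
  fixes x y z k :: int
  assumes "z + 4 * k + 3 \<le> x + y"
  shows "k + z div 4 \<le> x div 4 + y div 4"
proof -
  have "4 * (z div 4) \<le> z" "x \<le> 4 * (x div 4) + 3" "y \<le> 4 * (y div 4) + 3"
    by presburger+
  thus ?thesis using assms by linarith
qed

text \<open>The slope alone gives the gain from the second coefficient on. The linear coefficient, on which the slope has no
  effect, needs the precise form of the bound.\<close>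

lemma val_ge_step:
  assumes "val_ge c x"
  shows "val_ge (c + 1) (U7_image x (\<lambda>i. 4 * i))"
  unfolding val_ge_def coeff_U7_image
proof (intro conjI allI)
  have x0: "coeff x 0 = 0" and x: "pow7_dvd (c + (7 * int j - 7) div 4) (coeff x j)" for j
    using assms by (auto simp: val_ge_def)
  show "(\<Sum>i\<le>degree x. coeff x i * coeff (U_poly (4 * i)) (0 + i)) = 0"
  proof (intro sum.neutral ballI)
    fix i show "coeff x i * coeff (U_poly (4 * i)) (0 + i) = 0"
      using x0 coeff_U_poly[of "0 + i" "4 * i"] by (cases "i = 0") auto
  qed
  fix j
  show "pow7_dvd (c + 1 + (7 * int j - 7) div 4) (\<Sum>i\<le>degree x. coeff x i * coeff (U_poly (4 * i)) (j + i))"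
  proof (rule pow7_dvd_sum)
    fix i
    show "pow7_dvd (c + 1 + (7 * int j - 7) div 4) (coeff x i * coeff (U_poly (4 * i)) (j + i))"
    proof (cases "i = 0 \<or> j = 0")
      case True
      thus ?thesis using x0 coeff_U_poly[of "j + i" "4 * i"] by (cases "i = 0") auto
    next
      case False
      have "pow7_dvd (c + (7 * int i - 7) div 4 + (7 * int (j + i) - 2 * int (4 * i) - 1) div 4)
              (coeff x i * coeff (U_poly (4 * i)) (j + i))"
        by (rule pow7_dvd_mult[OF x conjunct1[OF coeff_U_poly]])
      moreover have "1 + (7 * J - 7) div 4 \<le> (7 * I - 7) div 4 + (7 * (J + I) - 2 * (4 * I) - 1) div 4"
        if "I \<ge> 1" for I J :: int
      proof (cases "I = 1")
        case True
        hence "(4 + (7 * J - 7)) div 4 \<le> (7 * (J + I) - 2 * (4 * I) - 1) div 4"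
          by (intro zdiv_mono1) simp_all
        moreover have "(4 + (7 * J - 7)) div 4 = 1 + (7 * J - 7) div 4"
          by (rule trans[OF div_add_self1]) simp_all
        ultimately show ?thesis using True by simp
      next
        case False
        thus ?thesis using that by (intro quarter_le) simp
      qed
      from this[of "int i" "int j"] have
        "c + 1 + (7 * int j - 7) div 4 \<le> c + (7 * int i - 7) div 4 + (7 * int (j + i) - 2 * int (4 * i) - 1) div 4"
        using False by simp
      ultimately show ?thesis by (rule pow7_dvd_mono)
    qed
  qed
qed

text \<open>No gain, but no loss: Watson's iteration gains \<open>7\<close> in only one of every two selections.\<close>

lemma val_ge_step_eta_quot:
  assumes "val_ge c x"
  shows "val_ge c (U7_image x (\<lambda>i. 4 * i + 1))"
  unfolding val_ge_def coeff_U7_image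
proof (intro conjI allI)
  have x0: "coeff x 0 = 0" and x: "pow7_dvd (c + (7 * int j - 7) div 4) (coeff x j)" for j
    using assms by (auto simp: val_ge_def)
  show "(\<Sum>i\<le>degree x. coeff x i * coeff (U_poly (4 * i + 1)) (0 + i)) = 0"
  proof (intro sum.neutral ballI)
    fix i show "coeff x i * coeff (U_poly (4 * i + 1)) (0 + i) = 0"
      using coeff_U_poly[of "0 + i" "4 * i + 1"] by auto
  qed
  fix j
  show "pow7_dvd (c + (7 * int j - 7) div 4) (\<Sum>i\<le>degree x. coeff x i * coeff (U_poly (4 * i + 1)) (j + i))"
  proof (rule pow7_dvd_sum)
    fix i
    show "pow7_dvd (c + (7 * int j - 7) div 4) (coeff x i * coeff (U_poly (4 * i + 1)) (j + i))"
    proof (cases "i = 0")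
      case True
      thus ?thesis using x0 by auto
    next
      case False
      have "pow7_dvd (c + (7 * int i - 7) div 4 + (7 * int (j + i) - 2 * int (4 * i + 1) - 1) div 4)
              (coeff x i * coeff (U_poly (4 * i + 1)) (j + i))"
        by (rule pow7_dvd_mult[OF x conjunct1[OF coeff_U_poly]])
      moreover have "0 + (7 * J - 7) div 4 \<le> (7 * I - 7) div 4 + (7 * (J + I) - 2 * (4 * I + 1) - 1) div 4"
        if "I \<ge> 1" for I J :: int
        using that by (intro quarter_le) simp
      from this[of "int i" "int j"] have
        "c + (7 * int j - 7) div 4 \<le> c + (7 * int i - 7) div 4 + (7 * int (j + i) - 2 * int (4 * i + 1) - 1) div 4"
        using False by simp
      ultimately show ?thesis by (rule pow7_dvd_mono)
    qed
  qed
qed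

text \<open>The first half of a double selection. Nothing can be gained, because \<open>U\<^sub>7(w\<^sup>3)\<close> contains \<open>3 t\<close>.\<close>

lemma val_ge_to_mid:
  assumes "val_ge c x"
  shows "val_ge_mid c (U7_image x (\<lambda>i. 4 * i - 1))"
  unfolding val_ge_mid_def coeff_U7_image
proof (intro allI pow7_dvd_sum)
  fix i j
  have x0: "coeff x 0 = 0" and x: "pow7_dvd (c + (7 * int j - 7) div 4) (coeff x j)" for j
    using assms by (auto simp: val_ge_def)
  show "pow7_dvd (c + 7 * int j div 4) (coeff x i * coeff (U_poly (4 * i - 1)) (j + i))"
  proof (cases "i = 0")
    case True
    thus ?thesis using x0 by auto
  next
    case False
    have "pow7_dvd (c + (7 * int i - 7) div 4 + (7 * int (j + i) - 2 * int (4 * i - 1) - 1) div 4)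
            (coeff x i * coeff (U_poly (4 * i - 1)) (j + i))"
      by (rule pow7_dvd_mult[OF x conjunct1[OF coeff_U_poly]])
    moreover have "0 + 7 * J div 4 \<le> (7 * I - 7) div 4 + (7 * (J + I) - 2 * (4 * I - 1) - 1) div 4"
      if "I \<ge> 1" for I J :: int
    proof (cases "I = 1")
      case False
      thus ?thesis using that by (intro quarter_le) simp
    qed simp
    from this[of "int i" "int j"] have
      "c + 7 * int j div 4 \<le> c + (7 * int i - 7) div 4 + (7 * int (j + i) - 2 * int (4 * i - 1) - 1) div 4"
      using False by (simp add: of_nat_diff)
    ultimately show ?thesis by (rule pow7_dvd_mono)
  qed
qed

lemma val_ge_from_mid:
  assumes "val_ge_mid c y"
  shows "val_ge (c + 1) (U7_image y (\<lambda>i. 4 * i + 1))"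
  unfolding val_ge_def coeff_U7_image
proof (intro conjI allI)
  have y: "pow7_dvd (c + 7 * int j div 4) (coeff y j)" for j
    using assms by (auto simp: val_ge_mid_def)
  show "(\<Sum>i\<le>degree y. coeff y i * coeff (U_poly (4 * i + 1)) (0 + i)) = 0"
  proof (intro sum.neutral ballI)
    fix i show "coeff y i * coeff (U_poly (4 * i + 1)) (0 + i) = 0"
      using coeff_U_poly[of "0 + i" "4 * i + 1"] by auto
  qed
  fix j
  show "pow7_dvd (c + 1 + (7 * int j - 7) div 4) (\<Sum>i\<le>degree y. coeff y i * coeff (U_poly (4 * i + 1)) (j + i))"
  proof (rule pow7_dvd_sum)
    fix i
    have "pow7_dvd (c + 7 * int i div 4 + (7 * int (j + i) - 2 * int (4 * i + 1) - 1) div 4)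
            (coeff y i * coeff (U_poly (4 * i + 1)) (j + i))"
      by (rule pow7_dvd_mult[OF y conjunct1[OF coeff_U_poly]])
    moreover have "1 + (7 * J - 7) div 4 \<le> 7 * I div 4 + (7 * (J + I) - 2 * (4 * I + 1) - 1) div 4"
      if "I \<ge> 0" for I J :: int
    proof (cases "I = 0")
      case True
      hence "7 * (J + I) - 2 * (4 * I + 1) - 1 = 4 + (7 * J - 7)" by simp
      hence "(7 * (J + I) - 2 * (4 * I + 1) - 1) div 4 = 1 + (7 * J - 7) div 4"
        by simp
      thus ?thesis using True by simp
    next
      case False
      thus ?thesis using that by (intro quarter_le) simp
    qed
    from this[of "int i" "int j"] have
      "c + 1 + (7 * int j - 7) div 4 \<le> c + 7 * int i div 4 + (7 * int (j + i) - 2 * int (4 * i + 1) - 1) div 4"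
      by simp
    ultimately show "pow7_dvd (c + 1 + (7 * int j - 7) div 4) (coeff y i * coeff (U_poly (4 * i + 1)) (j + i))"
      by (rule pow7_dvd_mono)
  qed
qed

lemma val_ge_U_poly_1: "val_ge 1 (U_poly 1)"
proof -
  have U1: "U_poly 1 = [:0, 7, 49:]" by (subst U_poly.simps) (simp add: newton_term_def)
  have "pow7_dvd (1 + (7 * int j - 7) div 4) (coeff (U_poly 1) j)" for j
  proof -
    consider "j = 0" | "j = 1" | "j = 2" | i where "j = Suc (Suc (Suc i))"
      by (metis One_nat_def Suc_1 not0_implies_Suc)
    thus ?thesis unfolding U1 by cases (auto simp: pow7_dvd_def numeral_2_eq_2)
  qed
  thus ?thesis unfolding val_ge_def U1 by simp
qed

lemma U7_val_ge:
  assumes "val_ge c x"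
  shows "U7 (ipoly hauptmodul x) = ipoly hauptmodul (U7_image x (\<lambda>i. 4 * i))"
proof -
  have "U7 (1 * ipoly hauptmodul x) = 1 * ipoly hauptmodul (U7_image x (\<lambda>i. 4 * i))"
  proof (rule U7_ipoly)
    fix i assume "coeff x i \<noteq> 0"
    hence "i \<ge> 1" using assms by (cases i) (auto simp: val_ge_def)
    thus "U7 (1 * hauptmodul ^ i) = 1 * ipoly hauptmodul (poly_shift i (U_poly (4 * i)))" by (rule U7_hauptmodul_power)
  qed
  thus ?thesis by simp
qed

lemma U7_eta_quot_ipoly: "U7 (eta_quot * ipoly hauptmodul x) = ipoly hauptmodul (U7_image x (\<lambda>i. 4 * i + 1))"
  using U7_ipoly[of x eta_quot 1 "\<lambda>i. 4 * i + 1"] U7_eta_quot_hauptmodul_power by simp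

lemma iterate_U7_val_ge:
  assumes "val_ge c x"
  shows "\<exists>y. val_ge (c + int n) y \<and> (U7 ^^ n) (ipoly hauptmodul x) = ipoly hauptmodul y"
proof (induction n)
  case (Suc n)
  then obtain y where y: "val_ge (c + int n) y" "(U7 ^^ n) (ipoly hauptmodul x) = ipoly hauptmodul y" by blast
  show ?case using val_ge_step[OF y(1)] U7_val_ge[OF y(1)] y(2) by (auto simp: algebra_simps)
qed (use assms in auto)

section \<open>Iterated selections\<close>

text \<open>The inverse of \<open>24\<close> modulo \<open>7\<^bsup>2j+1\<^esup>\<close>, by the closed form below: the residue class of Watson's congruence for odd exponents.\<close>

fun inv24 :: "nat \<Rightarrow> nat" where
  "inv24 0 = 5"
| "inv24 (Suc j) = inv24 j + 34 * 7 ^ (2 * j + 1)"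

lemma inv24: "24 * inv24 j = 17 * 7 ^ (2 * j + 1) + 1"
  by (induction j) auto

lemma euler7_dil: "euler 7 = dil7 (euler 1)" and euler49_dil: "euler 49 = dil7 (euler 7)"
  using euler_dil[of 7 1] euler_dil[of 7 7] by simp_all

text \<open>Watson's theorem for odd powers of \<open>7\<close> in the form of an expansion. One round selects the residues \<open>6\<close> and \<open>4\<close>. The first
  selection is \<open>U\<^sub>7\<close> itself and gains a factor \<open>7\<close>. The factor \<open>E\<^sub>7\<close> is used up by it and replaced by \<open>E\<^sub>1\<close>, and multiplication
  by \<open>w\<close> before the second selection restores \<open>E\<^sub>7\<close>.\<close>

theorem Watson_partition_series:
  "\<exists>x. val_ge (int j + 1) x \<and> q * euler 7 * progression (7 ^ (2 * j + 1)) (inv24 j) (inverse (euler 1)) = ipoly hauptmodul x"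
proof (induction j)
  case 0
  have "U7 (eta_quot ^ 1) = U7 (dil7 (euler 7) * (q\<^sup>2 * inverse (euler 1)))"
    by (simp add: eta_quot_def euler49_dil mult_ac)
  also have "\<dots> = q * euler 7 * progression 7 5 (inverse (euler 1))"
    unfolding U7_dil7_mult U7_shift[of 2, simplified] by (simp only: mult_ac)
  finally have "q * euler 7 * progression 7 5 (inverse (euler 1)) = ipoly hauptmodul (U_poly 1)"
    unfolding U7_eta_quot_power by (rule sym)
  thus ?case using val_ge_U_poly_1 by auto
next
  case (Suc j)
  define m where "m = (7::nat) ^ (2 * j + 1)"
  define g where "g = progression m (inv24 j) (inverse (euler 1))"
  obtain x where x: "val_ge (int j + 1) x" "q * euler 7 * g = ipoly hauptmodul x"
    using Suc unfolding g_def m_def by blast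
  define g' where "g' = progression 7 6 g"
  have "U7 (ipoly hauptmodul x) = U7 (dil7 (euler 1) * (q ^ 1 * g))"
    by (simp only: x(2)[symmetric] euler7_dil power_one_right mult_ac)
  also have "\<dots> = euler 1 * (q * g')"
    using U7_shift[of 1 g] by (simp only: U7_dil7_mult g'_def) simp
  finally have g': "euler 1 * (q * g') = ipoly hauptmodul (U7_image x (\<lambda>i. 4 * i))"
    using U7_val_ge[OF x(1)] by simp
  have "eta_quot * (euler 1 * (q * g')) = (eta_quot * euler 1) * (q * g')" by (simp only: mult.assoc)
  also have "\<dots> = dil7 (euler 7) * (q ^ 3 * g')"
    unfolding eta_quot_euler euler49_dil[symmetric] power3_eq_cube power2_eq_square by (simp only: mult_ac)
  finally have "eta_quot * (euler 1 * (q * g')) = dil7 (euler 7) * (q ^ 3 * g')" .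
  hence "U7 (eta_quot * ipoly hauptmodul (U7_image x (\<lambda>i. 4 * i))) = euler 7 * (q * progression 7 4 g')"
    unfolding g' by (simp only: U7_dil7_mult) (simp add: U7_shift)
  moreover have "euler 7 * (q * progression 7 4 g') = q * euler 7 * progression 7 4 g'" by (simp only: mult_ac)
  ultimately have "q * euler 7 * progression 7 4 g' = ipoly hauptmodul (U7_image (U7_image x (\<lambda>i. 4 * i)) (\<lambda>i. 4 * i + 1))"
    unfolding U7_eta_quot_ipoly by (simp only:)
  moreover have "progression 7 4 g' = progression (7 ^ (2 * Suc j + 1)) (inv24 (Suc j)) (inverse (euler 1))"
    by (simp add: g'_def g_def m_def progression_progression algebra_simps)
  moreover have "val_ge (int (Suc j) + 1) (U7_image (U7_image x (\<lambda>i. 4 * i)) (\<lambda>i. 4 * i + 1))"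
    using val_ge_step_eta_quot[OF val_ge_step[OF x(1)]] by (simp add: algebra_simps)
  ultimately show ?case by metis
qed

text \<open>The residues are \<open>1\<close> and then \<open>5\<close>, together \<open>36\<close> modulo \<open>49\<close>. They are dictated by the fractional exponents of \<open>q\<close> in powers
  of \<open>\<eta>(7\<tau>) / \<eta>(\<tau>)\<close>, which alternate between the classes of \<open>3/4\<close> and \<open>1/4\<close>.\<close>

lemma odd_step:
  assumes "val_ge c x" "q * H = eta_ratio_inv * ipoly hauptmodul x"
  shows "\<exists>y. val_ge (c + 1) y \<and> q * progression 49 36 H = eta_ratio_inv * ipoly hauptmodul y"
proof -
  define x1 where "x1 = U7_image x (\<lambda>i. 4 * i - 1)"
  have "q * progression 7 1 H = U7 (q ^ 5 * (q * H))"
    using U7_shift[of 6 H] by (simp add: mult.assoc[symmetric] flip: power_Suc2)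
  also have "\<dots> = U7 (q ^ 5 * eta_ratio_inv * ipoly hauptmodul x)" by (simp only: assms(2) mult.assoc)
  also have "\<dots> = q * eta_ratio * ipoly hauptmodul x1"
    unfolding x1_def
  proof (rule U7_ipoly)
    fix i assume "coeff x i \<noteq> 0"
    hence "i \<ge> 1" using assms(1) by (cases i) (auto simp: val_ge_def)
    thus "U7 (q ^ 5 * eta_ratio_inv * hauptmodul ^ i) = q * eta_ratio * ipoly hauptmodul (poly_shift i (U_poly (4 * i - 1)))" by (rule U7_eta_ratio_inv_hauptmodul_power)
  qed
  finally have H1: "progression 7 1 H = eta_ratio * ipoly hauptmodul x1" by (simp add: mult.assoc)
  have "q * progression 7 5 (progression 7 1 H) = U7 (q\<^sup>2 * progression 7 1 H)"
    using U7_shift[of 2 "progression 7 1 H"] by simp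
  also have "\<dots> = U7 (q\<^sup>2 * eta_ratio * ipoly hauptmodul x1)" by (simp only: H1 mult.assoc)
  also have "\<dots> = eta_ratio_inv * ipoly hauptmodul (U7_image x1 (\<lambda>i. 4 * i + 1))"
    by (rule U7_ipoly) (rule U7_eta_ratio_hauptmodul_power)
  finally have "q * progression 49 36 H = eta_ratio_inv * ipoly hauptmodul (U7_image x1 (\<lambda>i. 4 * i + 1))"
    by (simp add: progression_progression)
  moreover have "val_ge (c + 1) (U7_image x1 (\<lambda>i. 4 * i + 1))"
    unfolding x1_def by (intro val_ge_from_mid val_ge_to_mid assms)
  ultimately show ?thesis by blast
qed

lemma iterate_odd_step:
  assumes "val_ge c x" "q * H = eta_ratio_inv * ipoly hauptmodul x"
  shows "\<exists>y. val_ge (c + int n) y \<and> q * (progression 49 36 ^^ n) H = eta_ratio_inv * ipoly hauptmodul y"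
proof (induction n)
  case (Suc n)
  then obtain y where "val_ge (c + int n) y" "q * (progression 49 36 ^^ n) H = eta_ratio_inv * ipoly hauptmodul y" by blast
  from odd_step[OF this] show ?case by (simp add: algebra_simps)
qed (use assms in auto)

section \<open>From series to divisibility of coefficients\<close>

definition integral_fps :: "complex fps \<Rightarrow> bool" where
  "integral_fps g \<longleftrightarrow> (\<forall>n. g $ n \<in> \<int>)"

lemma integral_mult: "integral_fps f \<Longrightarrow> integral_fps g \<Longrightarrow> integral_fps (f * g)"
  by (auto simp: integral_fps_def fps_mult_nth)

lemma integral_power: "integral_fps f \<Longrightarrow> integral_fps (f ^ n)"
proof (induction n)
  case (Suc n)
  thus ?case by (simp add: integral_mult)
qed (simp add: integral_fps_def)

lemma integral_X [simp]: "integral_fps q"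
  by (simp add: integral_fps_def fps_X_def)

lemma integral_euler: "integral_fps (euler m)"
proof -
  have "integral_fps (qpoch m n)" for n
  proof (induction n)
    case (Suc n)
    have "integral_fps (1 - q ^ (m * Suc n))" by (simp add: integral_fps_def)
    thus ?case unfolding qpoch_Suc using Suc by (intro integral_mult)
  qed (simp add: integral_fps_def)
  thus ?thesis by (simp add: integral_fps_def euler_def)
qed

lemma integral_inverse:
  assumes "integral_fps f" "f $ 0 = 1"
  shows "integral_fps (inverse f)"
  unfolding integral_fps_def
proof
  fix n show "inverse f $ n \<in> \<int>"
  proof (induction n rule: less_induct)
    case (less n)
    show ?case
    proof (cases "n = 0")
      case False
      have "(f * inverse f) $ n = 0"
        using inverse_mult_eq_1'[of f] assms(2) False by simp
      also have "(f * inverse f) $ n = (\<Sum>i\<in>insert 0 {1..n}. f $ i * inverse f $ (n - i))"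
        unfolding fps_mult_nth by (intro sum.cong) auto
      also have "\<dots> = inverse f $ n + (\<Sum>i\<in>{1..n}. f $ i * inverse f $ (n - i))"
        using assms(2) by (subst sum.insert) auto
      finally have "inverse f $ n = - (\<Sum>i\<in>{1..n}. f $ i * inverse f $ (n - i))"
        by (simp add: eq_neg_iff_add_eq_0)
      moreover have "(\<Sum>i\<in>{1..n}. f $ i * inverse f $ (n - i)) \<in> \<int>"
        using less assms(1) by (intro Ints_sum Ints_mult) (auto simp: integral_fps_def)
      ultimately show ?thesis by simp
    qed (use assms in simp)
  qed
qed

lemma integral_hauptmodul: "integral_fps hauptmodul"
  unfolding hauptmodul_def by (intro integral_mult integral_power integral_inverse integral_euler integral_X) simp

lemma integral_ipoly: "integral_fps (ipoly hauptmodul y)"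
proof (induction y)
  case (pCons c y)
  hence "integral_fps (hauptmodul * ipoly hauptmodul y)" by (intro integral_mult integral_hauptmodul)
  moreover have "of_int c $ n \<in> (\<int> :: complex set)" for n
    by (simp flip: fps_of_int)
  ultimately show ?case by (simp add: integral_fps_def)
qed (simp add: integral_fps_def)

text \<open>All coefficients of \<open>x\<close> are divisible by \<open>7\<^sup>c\<close>, and everything else in the product has integer coefficients.\<close>

lemma val_ge_imp_dvd:
  assumes "val_ge (int c) x" "integral_fps g" "(g * ipoly hauptmodul x) $ n = of_nat b"
  shows "7 ^ c dvd b"
proof -
  have "7 ^ c dvd coeff x i" for i
  proof (cases "i = 0")
    case False
    have "pow7_dvd (int c + (7 * int i - 7) div 4) (coeff x i)" using assms(1) by (simp add: val_ge_def)
    hence "pow7_dvd (int c) (coeff x i)" using False by (elim pow7_dvd_mono) simp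
    thus ?thesis by (simp add: pow7_dvd_def)
  qed (use assms in \<open>simp add: val_ge_def\<close>)
  hence "[:7 ^ c:] dvd x" by (simp add: const_poly_dvd_iff)
  then obtain y where "x = smult (7 ^ c) y" by (auto elim!: dvdE)
  hence "g * ipoly hauptmodul x = fps_const (of_int (7 ^ c)) * (g * ipoly hauptmodul y)"
    by (simp add: ipoly_smult mult_ac flip: fps_of_int)
  hence eq: "(g * ipoly hauptmodul x) $ n = of_int (7 ^ c) * (g * ipoly hauptmodul y) $ n"
    by (simp only: fps_mult_left_const_nth)
  have "integral_fps (g * ipoly hauptmodul y)" by (intro integral_mult assms integral_ipoly)
  then obtain z where "(g * ipoly hauptmodul y) $ n = of_int z" by (auto simp: integral_fps_def elim: Ints_cases)
  hence "(of_int (int b) :: complex) = of_int (7 ^ c * z)" using eq assms(3) by simp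
  hence "int b = 7 ^ c * z" by (simp only: of_int_eq_iff)
  hence "int (7 ^ c) dvd int b" by simp
  thus ?thesis by (simp only: of_nat_dvd_iff)
qed

lemma b_reg_progression:
  assumes "i \<le> j" "r < 7 ^ i"
  shows "Abs_fps (\<lambda>n. of_nat (b_reg (7 ^ j) (7 ^ i * n + r))) = euler (7 ^ (j - i)) * progression (7 ^ i) r (inverse (euler 1))"
proof -
  have euler_inv: "euler 1 $ 0 \<noteq> 0" by simp
  have "Abs_fps (\<lambda>n. of_nat (b_reg (7 ^ j) n)) * euler 1 * inverse (euler 1) = euler (7 ^ j) * inverse (euler 1)"
    by (subst b_reg_generating_function) simp_all
  hence "Abs_fps (\<lambda>n. of_nat (b_reg (7 ^ j) n)) = euler (7 ^ j) * inverse (euler 1)"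
    using inverse_mult_eq_1'[of "euler 1", OF euler_inv] by (simp only: mult.assoc mult_1_right)
  moreover have "euler (7 ^ j) = euler (7 ^ (j - i)) oo q ^ (7 ^ i)"
    using euler_dil[of "7 ^ i" "7 ^ (j - i)"] assms(1) by (simp flip: power_add)
  ultimately have "progression (7 ^ i) r (Abs_fps (\<lambda>n. of_nat (b_reg (7 ^ j) n)))
      = euler (7 ^ (j - i)) * progression (7 ^ i) r (inverse (euler 1))"
    using progression_dil_mult[OF assms(2)] by simp
  thus ?thesis by (simp add: progression_def)
qed

lemma U7_iterate_nth: "(U7 ^^ n) g $ m = g $ (7 ^ n * m)"
  by (induction n arbitrary: m) (simp_all add: U7_nth mult_ac)

text \<open>The offset is \<open>3 (49\<^sup>n - 1) / 4\<close>, stated without division.\<close>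

lemma progression_iterate_nth: "\<exists>\<rho>. 4 * \<rho> + 3 = 3 * 49 ^ n \<and> (\<forall>m. (progression 49 36 ^^ n) g $ m = g $ (49 ^ n * m + \<rho>))"
proof (induction n)
  case (Suc n)
  then obtain \<rho> where \<rho>: "4 * \<rho> + 3 = 3 * 49 ^ n" "\<And>m. (progression 49 36 ^^ n) g $ m = g $ (49 ^ n * m + \<rho>)"
    by blast
  have "4 * (49 ^ n * 36 + \<rho>) + 3 = 3 * 49 ^ Suc n" using \<rho>(1) by simp
  moreover have "(progression 49 36 ^^ Suc n) g $ m = g $ (49 ^ Suc n * m + (49 ^ n * 36 + \<rho>))" for m
    by (simp add: progression_nth \<rho>(2) algebra_simps)
  ultimately show ?case by blast
qed auto

lemma inv24_less: "inv24 j < 7 ^ (2 * j + 1)"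
proof -
  have "24 * inv24 j < 24 * 7 ^ (2 * j + 1)" unfolding inv24 using one_le_power[of "7::nat" "2 * j + 1"] by linarith
  thus ?thesis by simp
qed

text \<open>Here the factor left over from the numerator is \<open>E\<^sub>7\<close>, exactly the one in Watson's expansion, so \<open>U\<^sub>7\<close> can be
  iterated on polynomials in the Hauptmodul.\<close>

theorem even_power_congruence:
  "7 ^ (j + 1 + \<beta>) dvd b_reg (7 ^ (2 * j + 2)) (7 ^ (2 * j + 1) * (7 ^ \<beta> * (n + 1) - 1) + inv24 j)"
proof -
  define H where "H = (Abs_fps (\<lambda>n. of_nat (b_reg (7 ^ (2 * j + 2)) (7 ^ (2 * j + 1) * n + inv24 j))) :: complex fps)"
  obtain x where x: "val_ge (int j + 1) x" "q * euler 7 * progression (7 ^ (2 * j + 1)) (inv24 j) (inverse (euler 1)) = ipoly hauptmodul x"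
    using Watson_partition_series by blast
  have "H = euler 7 * progression (7 ^ (2 * j + 1)) (inv24 j) (inverse (euler 1))"
    unfolding H_def using b_reg_progression[OF _ inv24_less, of j "2 * j + 2"] by simp
  hence qH: "q * H = ipoly hauptmodul x" using x(2) by (simp add: mult.assoc)
  obtain y where y: "val_ge (int j + 1 + int \<beta>) y" "(U7 ^^ \<beta>) (q * H) = ipoly hauptmodul y"
    using iterate_U7_val_ge[OF x(1)] unfolding qH by blast
  have "(1 * ipoly hauptmodul y) $ (n + 1) = (q * H) $ (7 ^ \<beta> * (n + 1))"
    by (simp only: y(2)[symmetric] U7_iterate_nth mult_1_left)
  also have "\<dots> = of_nat (b_reg (7 ^ (2 * j + 2)) (7 ^ (2 * j + 1) * (7 ^ \<beta> * (n + 1) - 1) + inv24 j))"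
    by (simp add: H_def)
  finally have "(1 * ipoly hauptmodul y) $ (n + 1) = \<dots>" .
  thus ?thesis using y(1) by (intro val_ge_imp_dvd[of _ y 1]) (auto simp: integral_fps_def add_ac)
qed

text \<open>Here the factor left over from the numerator is \<open>E\<^sub>1\<close> instead of \<open>E\<^sub>7\<close>, which brings in the ratio \<open>E\<^sub>1 / E\<^sub>7\<close>.\<close>

theorem odd_power_congruence:
  assumes "4 * \<rho> + 3 = 3 * 49 ^ \<beta>"
  shows "7 ^ (j + 1 + \<beta>) dvd b_reg (7 ^ (2 * j + 1)) (7 ^ (2 * j + 1) * (49 ^ \<beta> * n + \<rho>) + inv24 j)"
proof -
  define H where "H = (Abs_fps (\<lambda>n. of_nat (b_reg (7 ^ (2 * j + 1)) (7 ^ (2 * j + 1) * n + inv24 j))) :: complex fps)"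
  define g where "g = progression (7 ^ (2 * j + 1)) (inv24 j) (inverse (euler 1))"
  obtain x where x: "val_ge (int j + 1) x" "q * euler 7 * g = ipoly hauptmodul x"
    using Watson_partition_series unfolding g_def by blast
  have "H = euler 1 * g"
    unfolding H_def g_def using b_reg_progression[OF _ inv24_less, of j "2 * j + 1"] by simp
  hence qH: "q * H = eta_ratio_inv * ipoly hauptmodul x"
    unfolding x(2)[symmetric] eta_ratio_inv_euler[symmetric] by (simp only: mult_ac)
  obtain y where y: "val_ge (int j + 1 + int \<beta>) y" "q * (progression 49 36 ^^ \<beta>) H = eta_ratio_inv * ipoly hauptmodul y"
    using iterate_odd_step[OF x(1) qH] by blast
  obtain \<rho>' where \<rho>': "4 * \<rho>' + 3 = 3 * 49 ^ \<beta>" "\<And>m. (progression 49 36 ^^ \<beta>) H $ m = H $ (49 ^ \<beta> * m + \<rho>')"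
    using progression_iterate_nth by blast
  have "\<rho>' = \<rho>" using assms \<rho>'(1) by simp
  have "(eta_ratio_inv * ipoly hauptmodul y) $ (n + 1) = (progression 49 36 ^^ \<beta>) H $ n"
    unfolding y(2)[symmetric] by simp
  also have "\<dots> = of_nat (b_reg (7 ^ (2 * j + 1)) (7 ^ (2 * j + 1) * (49 ^ \<beta> * n + \<rho>) + inv24 j))"
    unfolding \<rho>'(2) \<open>\<rho>' = \<rho>\<close> by (simp add: H_def)
  finally have "(eta_ratio_inv * ipoly hauptmodul y) $ (n + 1) = \<dots>" .
  moreover have "integral_fps eta_ratio_inv"
    unfolding eta_ratio_inv_def by (intro integral_mult integral_euler integral_inverse) simp
  ultimately show ?thesis using y(1) by (intro val_ge_imp_dvd[of _ y eta_ratio_inv]) (auto simp: add_ac)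
qed

theorem theorem1p1:
  fixes n \<beta> k :: nat
  assumes "k \<ge> 1"
  shows "[b_reg (7 ^ (2*k - 1))
            (7 ^ (2*k + 2*\<beta> - 1) * n
              + (18 * 7 ^ (2*k + 2*\<beta> - 1) - 7 ^ (2*k - 1) + 1) div 24) = 0]
         (mod 7 ^ (k + \<beta>)) \<and>
         [b_reg (7 ^ (2*k))
            (7 ^ (2*k + \<beta> - 1) * (n + 1) - (7 ^ (2*k) - 1) div 24) = 0]
         (mod 7 ^ (k + \<beta>))"
proof -
  obtain j where k: "k = j + 1" using assms by (metis add.commute le_Suc_ex)
  define m where "m = (7::nat) ^ (2 * j + 1)"
  have inv24: "24 * inv24 j = 17 * m + 1" by (simp add: inv24 m_def)
  have m1: "m \<ge> 1" by (simp add: m_def)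
  have odd_exp: "2 * k - 1 = 2 * j + 1" "2 * k + 2 * \<beta> - 1 = (2 * j + 1) + 2 * \<beta>" by (simp_all add: k)
  have even_exp: "2 * k = 2 * j + 2" "2 * k + \<beta> - 1 = (2 * j + 1) + \<beta>" by (simp_all add: k)
  obtain \<rho> :: nat where \<rho>: "4 * \<rho> + 3 = 3 * 49 ^ \<beta>"
    using progression_iterate_nth by blast
  have p49: "(7::nat) ^ (2 * j + 1 + 2 * \<beta>) = m * 49 ^ \<beta>"
    by (simp add: m_def power_add power_mult)
  \<comment> \<open>Here \<open>\<rho> = 3 (49\<^sup>\<beta> - 1) / 4\<close>.\<close>
  have "24 * (m * \<rho> + inv24 j) = 6 * (m * (4 * \<rho> + 3)) - m + 1"
    using inv24 m1 by (simp add: algebra_simps)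
  hence arg: "(18 * (m * 49 ^ \<beta>) - m + 1) div 24 = m * \<rho> + inv24 j"
    unfolding \<rho> by simp
  have "7 ^ (j + 1 + \<beta>) dvd b_reg (7 ^ (2 * j + 1)) (m * (49 ^ \<beta> * n + \<rho>) + inv24 j)"
    unfolding m_def by (rule odd_power_congruence[OF \<rho>])
  also have "m * (49 ^ \<beta> * n + \<rho>) + inv24 j = m * 49 ^ \<beta> * n + (18 * (m * 49 ^ \<beta>) - m + 1) div 24"
    unfolding arg by (simp add: algebra_simps)
  finally have odd: "[b_reg (7 ^ (2*k - 1))
            (7 ^ (2*k + 2*\<beta> - 1) * n
              + (18 * 7 ^ (2*k + 2*\<beta> - 1) - 7 ^ (2*k - 1) + 1) div 24) = 0] (mod 7 ^ (k + \<beta>))"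
    unfolding odd_exp p49 cong_0_iff by (simp add: k m_def)
  define X where "X = (7::nat) ^ \<beta> * (n + 1)"
  have mX: "7 ^ (2 * j + 1 + \<beta>) * (n + 1) = m * X"
    by (simp only: m_def X_def power_add mult.assoc)
  have X: "X \<ge> 1" by (simp add: X_def Suc_le_eq)
  have "(7::nat) ^ (2 * j + 2) = 7 * m" by (simp add: m_def)
  hence "(7 ^ (2 * j + 2) - 1) div 24 = m - inv24 j" using inv24 by simp
  moreover have "inv24 j \<le> m" using inv24 m1 by simp
  moreover have "m * X = m * (X - 1) + m" using X by (simp add: algebra_simps)
  ultimately have arg2: "m * X - (7 ^ (2 * j + 2) - 1) div 24 = m * (X - 1) + inv24 j" by simp
  have "7 ^ (j + 1 + \<beta>) dvd b_reg (7 ^ (2 * j + 2)) (m * (X - 1) + inv24 j)"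
    unfolding m_def X_def by (rule even_power_congruence)
  hence even: "[b_reg (7 ^ (2*k)) (7 ^ (2*k + \<beta> - 1) * (n + 1) - (7 ^ (2*k) - 1) div 24) = 0] (mod 7 ^ (k + \<beta>))"
    unfolding even_exp(2) mX cong_0_iff unfolding even_exp(1) arg2 by (simp only: k)
  show ?thesis using odd even by blast
qed

end
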